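(* Let $\mathcal{X}=\{0,1\}$, let the source symbols be i.i.d. with $P_X(0)=p$, $P_X(1)=1-p$, where $p\le 1/2$, and let $\mathsf{d}\in(0,p)$. Let $\mathscr{U}:\mathcal{X}\times\mathcal{X}\to\mathbb{R}$ be the sender's utility, with $\mathscr{U}(0,0)=\mathscr{U}(1,1)=0$. Then $\mathcal{R}_{\mathsf d}\ne\emptyset$ if and only if $$\mathscr{U}(0,1)+\mathscr{U}(1,0)<0 .$$ (a) If $\mathscr{U}(0,1)+\mathscr{U}(1,0)<0$, then $\mathcal{R}_{\mathsf d}^{\inf}=R(\mathsf d)$; and $\mathcal{R}_{\mathsf d}^{\sup}\in[H(p+\mathsf d),1]$ if $p+\mathsf d<\frac12$, while $\mathcal{R}_{\mathsf d}^{\sup}=1$ otherwise. (b) If $\mathscr{U}(0,1)<0$ and $\mathscr{U}(1,0)<0$, then $\mathcal{R}_{\mathsf d}=[R(\mathsf d),1]$. Finally, if instead $\mathsf d\in(0,1]$ satisfies $\mathsf d\ge p$, then $\mathcal{R}_{\mathsf d}^{\inf}=0$.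
   Context: All logarithms are base 2 and $H(t)=-t\log t-(1-t)\log(1-t)$ is the binary entropy. $R(\mathsf d)=\inf\{I(X;Y): P_{Y|X},\ \mathbb{E}[d(X,Y)]\le\mathsf d\}$ is the rate-distortion function of the source $X\sim P_X$ under Hamming distortion $d(x,y)=\mathbf 1[x\neq y]$, where $(X,Y)\sim P_XP_{Y|X}$ and $I$ is mutual information. Setting. $\mathcal{X}$ is a finite alphabet, $P_X$ a probability distribution on $\mathcal{X}$, and $X=(X_1,\dots,X_n)$ has i.i.d. $P_X$ components. A sender strategy is a function $s_n:\mathcal{X}^n\to\mathcal{X}^n$; a receiver strategy is a function $g_n:\mathcal{X}^n\to\mathcal{X}^n$ (both deterministic). The normalized Hamming distance is $d_n(\hat x,x)=\frac1n|\{k:\hat x_k\ne x_k\}|$. The sender's $n$-block utility is $\mathscr{U}_n(\hat x,x)=\frac1n\sum_{i=1}^n\mathscr{U}(\hat x_i,x_i)$, where the first argument is the recovered sequence and the second the observed one. Best responses: $\mathscr{B}(g_n)$ is the set of all $s_n$ such that $\mathscr{U}_n(g_n(s_n(x)),x)\ge \mathscr{U}_n(g_n(s_n'(x)),x)$ for all $x\in\mathcal{X}^n$ and all sender strategies $s_n'$. For a distortion level $\mathsf{d}$: $\mathcal{D}_{\mathsf d}(g_n,s_n)=\{x\in\mathcal{X}^n: d_n(g_n(s_n(x)),x)\le\mathsf{d}\}$; probability of error $\mathcal{E}_{\mathsf d}(g_n,s_n)=1-\mathbb{P}(X\in\mathcal{D}_{\mathsf d}(g_n,s_n))$; worst-case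 best responses $\mathscr{S}_{\mathsf d}(g_n)=\arg\max_{s_n\in\mathscr{B}(g_n)}\mathcal{E}_{\mathsf d}(g_n,s_n)$; $\mathcal{A}^n_{\mathsf d}(g_n,s_n)=\{\hat x\in\mathrm{Im}(g_n):\exists x\in\mathcal{D}_{\mathsf d}(g_n,s_n),\ g_n(s_n(x))=\hat x\}$; rate $R_{\mathsf d}(g_n,s_n)=\frac1n\log|\mathcal{A}^n_{\mathsf d}(g_n,s_n)|$. A rate $R$ is achievable at level $\mathsf{d}$ if there exist receiver strategies $\{g_n\}_{n\ge1}$, $s_n\in\mathscr{S}_{\mathsf d+\delta_n}(g_n)$, and sequences of positive reals $\epsilon_n,\delta_n\to0$ such that $\mathcal{E}_{\mathsf d+\delta_n}(g_n,s_n)<\epsilon_n$ for all $n$ and $\lim_{n\to\infty}R_{\mathsf d+\delta_n}(g_n,s_n)=R$. $\mathcal{R}_{\mathsf d}$ is the set of achievable rates, $\mathcal{R}_{\mathsf d}^{\inf}=\inf\mathcal{R}_{\mathsf d}$, $\mathcal{R}_{\mathsf d}^{\sup}=\sup\mathcal{R}_{\mathsf d}$. *)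

theory Defs
  imports "HOL-Probability.Probability" "HOL-Library.Z2"
begin

instance bit :: finite
proof
  have "(UNIV :: bit set) \<subseteq> {0, 1}"
    using bit.exhaust by blast
  then show "finite (UNIV :: bit set)"
    by (rule finite_subset) simp
qed

section \<open>Binary entropy and the rate-distortion function\<close>

definition binary_entropy :: "real \<Rightarrow> real" where
  "binary_entropy t = - t * log 2 t - (1 - t) * log 2 (1 - t)"

text \<open>A conditional distribution of \<open>Y\<close> given \<open>X\<close> is a map \<open>W :: 'a \<Rightarrow> 'a pmf\<close>.\<close>

definition joint_pmf :: "'a pmf \<Rightarrow> ('a \<Rightarrow> 'a pmf) \<Rightarrow> ('a \<times> 'a) pmf" where
  "joint_pmf P W = bind_pmf P (\<lambda>x. map_pmf (\<lambda>y. (x, y)) (W x))"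

definition mutual_info :: "('a \<times> 'a) pmf \<Rightarrow> real" where
  "mutual_info J =
     prob_space.mutual_information (measure_pmf J) 2 (count_space UNIV) (count_space UNIV) fst snd"

definition hamming :: "'a \<Rightarrow> 'a \<Rightarrow> real" where
  "hamming x y = (if x \<noteq> y then 1 else 0)"

definition rate_distortion :: "'a::finite pmf \<Rightarrow> real \<Rightarrow> real" where
  "rate_distortion P d =
     Inf {mutual_info (joint_pmf P W) | W.
            measure_pmf.expectation (joint_pmf P W) (\<lambda>(x, y). hamming x y) \<le> d}"

section \<open>The communication game\<close>

text \<open>Sequences of length \<open>n\<close> over the alphabet \<open>'a\<close> are extensional functions on \<open>{..<n}\<close>, so
  coordinates are numbered from \<open>0\<close>.\<close>

definition seqs :: "nat \<Rightarrow> (nat \<Rightarrow> 'a::finite) set" where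
  "seqs n = {..<n} \<rightarrow>\<^sub>E UNIV"

definition source :: "'a::finite pmf \<Rightarrow> nat \<Rightarrow> (nat \<Rightarrow> 'a) pmf" where
  "source P n = Pi_pmf {..<n} undefined (\<lambda>_. P)"

type_synonym 'a strategy = "(nat \<Rightarrow> 'a) \<Rightarrow> (nat \<Rightarrow> 'a)"

definition strategies :: "nat \<Rightarrow> 'a::finite strategy set" where
  "strategies n = seqs n \<rightarrow>\<^sub>E seqs n"

definition block_dist :: "nat \<Rightarrow> (nat \<Rightarrow> 'a) \<Rightarrow> (nat \<Rightarrow> 'a) \<Rightarrow> real" where
  "block_dist n xh x = real (card {k \<in> {..<n}. xh k \<noteq> x k}) / real n"

text \<open>In utilities, the first argument is the recovered symbol or sequence and the second the
  observed one.\<close>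

definition block_utility ::
    "('a \<Rightarrow> 'a \<Rightarrow> real) \<Rightarrow> nat \<Rightarrow> (nat \<Rightarrow> 'a) \<Rightarrow> (nat \<Rightarrow> 'a) \<Rightarrow> real" where
  "block_utility U n xh x = (\<Sum>i<n. U (xh i) (x i)) / real n"

definition best_responses ::
    "('a::finite \<Rightarrow> 'a \<Rightarrow> real) \<Rightarrow> nat \<Rightarrow> 'a strategy \<Rightarrow> 'a strategy set" where
  "best_responses U n g =
     {s \<in> strategies n. \<forall>x \<in> seqs n. \<forall>s' \<in> strategies n.
        block_utility U n (g (s x)) x \<ge> block_utility U n (g (s' x)) x}"

definition decoded_set ::
    "real \<Rightarrow> nat \<Rightarrow> 'a::finite strategy \<Rightarrow> 'a strategy \<Rightarrow> (nat \<Rightarrow> 'a) set" where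
  "decoded_set d n g s = {x \<in> seqs n. block_dist n (g (s x)) x \<le> d}"

definition error_prob ::
    "'a::finite pmf \<Rightarrow> real \<Rightarrow> nat \<Rightarrow> 'a strategy \<Rightarrow> 'a strategy \<Rightarrow> real" where
  "error_prob P d n g s = 1 - measure_pmf.prob (source P n) (decoded_set d n g s)"

definition worst_responses ::
    "'a::finite pmf \<Rightarrow> ('a \<Rightarrow> 'a \<Rightarrow> real) \<Rightarrow> real \<Rightarrow> nat \<Rightarrow> 'a strategy \<Rightarrow> 'a strategy set" where
  "worst_responses P U d n g =
     {s. is_arg_max (error_prob P d n g) (\<lambda>s. s \<in> best_responses U n g) s}"

definition recovered_set ::
    "real \<Rightarrow> nat \<Rightarrow> 'a::finite strategy \<Rightarrow> 'a strategy \<Rightarrow> (nat \<Rightarrow> 'a) set" where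
  "recovered_set d n g s = {xh \<in> g ` seqs n. \<exists>x \<in> decoded_set d n g s. g (s x) = xh}"

text \<open>If \<open>recovered_set d n g s\<close> is empty then \<open>block_rate\<close> is \<open>0\<close> instead of minus infinity. In
  \<open>achievable\<close> this concerns only finitely many \<open>n\<close>, as the set is nonempty once the error
  probability is below \<open>1\<close>.\<close>

definition block_rate :: "real \<Rightarrow> nat \<Rightarrow> 'a::finite strategy \<Rightarrow> 'a strategy \<Rightarrow> real" where
  "block_rate d n g s = log 2 (real (card (recovered_set d n g s))) / real n"

definition achievable ::
    "'a::finite pmf \<Rightarrow> ('a \<Rightarrow> 'a \<Rightarrow> real) \<Rightarrow> real \<Rightarrow> real \<Rightarrow> bool" where
  "achievable P U d R \<longleftrightarrow>
     (\<exists>(g :: nat \<Rightarrow> 'a strategy) (s :: nat \<Rightarrow> 'a strategy) (\<epsilon> :: nat \<Rightarrow> real) (\<delta> :: nat \<Rightarrow> real).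
        (\<forall>n\<ge>1. g n \<in> strategies n \<and> \<epsilon> n > 0 \<and> \<delta> n > 0 \<and>
               s n \<in> worst_responses P U (d + \<delta> n) n (g n) \<and>
               error_prob P (d + \<delta> n) n (g n) (s n) < \<epsilon> n) \<and>
        \<epsilon> \<longlonglongrightarrow> 0 \<and> \<delta> \<longlonglongrightarrow> 0 \<and>
        (\<lambda>n. block_rate (d + \<delta> n) n (g n) (s n)) \<longlonglongrightarrow> R)"

definition achievable_rates ::
    "'a::finite pmf \<Rightarrow> ('a \<Rightarrow> 'a \<Rightarrow> real) \<Rightarrow> real \<Rightarrow> real set" where
  "achievable_rates P U d = {R. achievable P U d R}"

text \<open>The extremes are extended reals, so that the infimum and supremum of the empty set have
  their usual values.\<close>

definition rate_inf :: "'a::finite pmf \<Rightarrow> ('a \<Rightarrow> 'a \<Rightarrow> real) \<Rightarrow> real \<Rightarrow> ereal" where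
  "rate_inf P U d = Inf (ereal ` achievable_rates P U d)"

definition rate_sup :: "'a::finite pmf \<Rightarrow> ('a \<Rightarrow> 'a \<Rightarrow> real) \<Rightarrow> real \<Rightarrow> ereal" where
  "rate_sup P U d = Sup (ereal ` achievable_rates P U d)"

end

theory Submission
  imports Defs "HOL-Real_Asymp.Real_Asymp"
begin

text \<open>Write \<open>a = U 0 1\<close> and \<open>b = U 1 0\<close>. If \<open>w\<close> counts zeros, the utility of \<open>y\<close> for the type \<open>x\<close> is
  \<open>(a + b) / 2\<close> times the Hamming distance of \<open>x\<close> and \<open>y\<close> plus \<open>(a - b) / 2\<close> times \<open>(w y - w x) / n\<close>.
  On an image of constant \<open>w\<close> and for \<open>a + b < 0\<close> the sender thus picks a nearest sequence, however
  ties are broken, and the receiver may use any constant-weight rate-distortion code. A greedy covering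
  of the sequences with about \<open>n p\<close> zeros attains every rate \<open>H(p) - H(\<theta>)\<close> with \<open>0 < \<theta> \<le> d\<close>, and a
  full layer of sequences with about \<open>n t\<close> zeros, \<open>\<bar>t - p\<bar> \<le> d\<close>, attains \<open>H(t)\<close>. If \<open>a\<close> and \<open>b\<close> are both
  negative, every element of the image is its own best report, and the image may be enlarged from the
  typical set to reach the rates between \<open>H(p)\<close> and \<open>1\<close>. The lower bound \<open>R(d)\<close> is the volume bound for
  Hamming balls. Incentive compatibility for
  \<open>a + b > 0\<close>, and adverse tie-breaking for \<open>a + b = 0\<close>, make the decoded set asymptotically null.\<close>

section \<open>The binary rate-distortion function\<close>

text \<open>The obstacle is the term in the numbers of zeros: unless \<open>U 0 1 = U 1 0\<close>,
  it draws the sender towards sequences with many or with few zeros, away from the nearest codeword.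
  Within one layer this term is the same for all reports of a type. A second difficulty is that the
  rate counts only recovered sequences that are reached from decoded types, and ties leave open
  which these are. The size of the image thus bounds the rate only from above. The matching lower
  bound is the converse, applied to the code itself at its own level \<theta>, and carried over to
  \<open>d\<close> because the rate grows with the level. For this the volume bound keeps a fixed
  \<theta> apart from the actual level and has an error linear in their difference. In the layer
  codes the slack \<open>\<delta> n\<close> is of order n^(-1/4). It pays for moving a typical
  sequence into a single layer and for rounding, so that only this layer has to be covered. The
  estimates hold uniformly over all best responses; the choice of a worst one enters only for
  \<open>U 0 1 + U 1 0 = 0\<close>.\<close>

lemma UNIV_bit: "(UNIV :: bit set) = {0, 1}"
  using bit.exhaust by blast

lemma sum_bit: "(\<Sum>x\<in>(UNIV::bit set). f x) = f 0 + f 1"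
  by (simp add: UNIV_bit)

lemma sum_bit_prod:
  "(\<Sum>(x, y)\<in>(UNIV :: (bit \<times> bit) set). f x y) = (f 0 0 + f 0 1) + (f 1 0 + f 1 1)"
  using sum.cartesian_product[of f "UNIV :: bit set" "UNIV :: bit set"]
  by (simp add: sum_bit del: UNIV_Times_UNIV) (simp add: UNIV_Times_UNIV)

section \<open>Mutual information and distortion of a pair of bits as finite sums\<close>

lemma pmf_joint_pmf:
  "pmf (joint_pmf P W) (x, y) = pmf P x * pmf (W x) y"
proof -
  have "pmf (map_pmf (Pair x') (W x')) (x, y) = indicator {x} x' * pmf (W x) y" for x'
    by (cases "x = x'") (auto simp: pmf_map_inj' inj_on_def pmf_map_outside image_iff intro!: pmf_map_outside)
  then show ?thesis
    unfolding joint_pmf_def pmf_bind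
    by (simp add: measure_pmf_single)
qed

lemma mutual_info_eq_sum:
  fixes J :: "('a::finite \<times> 'a) pmf"
  shows "mutual_info J = (\<Sum>(x, y)\<in>UNIV.
    pmf J (x, y) * log 2 (pmf J (x, y) / (pmf (map_pmf fst J) x * pmf (map_pmf snd J) y)))"
proof -
  interpret information_space "measure_pmf J" 2
    by unfold_locales auto
  have fin: "sigma_finite_measure (count_space (UNIV :: 'a set))"
    by (simp add: sigma_finite_measure_count_space_finite)
  have D: "distributed (measure_pmf J) (count_space UNIV) f (\<lambda>x. ennreal (pmf (map_pmf f J) x))"
    for f :: "'a \<times> 'a \<Rightarrow> 'b"
    unfolding distributed_def
    by (auto simp: map_pmf_rep_eq[symmetric] measure_pmf_eq_density[symmetric])
  have D2: "distributed (measure_pmf J) (count_space UNIV \<Otimes>\<^sub>M count_space UNIV) (\<lambda>x. (fst x, snd x))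
      (\<lambda>x. ennreal (pmf J x))"
    using D[of "\<lambda>x. x"] by (simp add: pair_measure_count_space)
  show ?thesis
    unfolding mutual_info_def
    by (subst mutual_information_distr[OF fin fin D _ D _ D2])
       (auto simp: pair_measure_count_space lebesgue_integral_count_space_finite split_beta')
qed

lemma mutual_info_bit:
  fixes J :: "(bit \<times> bit) pmf"
  defines "j \<equiv> \<lambda>x y. pmf J (x, y)"
  shows "mutual_info J =
    (j 0 0 * log 2 (j 0 0 / ((j 0 0 + j 0 1) * (j 0 0 + j 1 0))) +
     j 0 1 * log 2 (j 0 1 / ((j 0 0 + j 0 1) * (j 0 1 + j 1 1)))) +
    (j 1 0 * log 2 (j 1 0 / ((j 1 0 + j 1 1) * (j 0 0 + j 1 0))) +
     j 1 1 * log 2 (j 1 1 / ((j 1 0 + j 1 1) * (j 0 1 + j 1 1))))"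
proof -
  have fst: "pmf (map_pmf fst J) x = j x 0 + j x 1" for x
  proof -
    have "fst -` {x} = {(x, 0 :: bit), (x, 1)}"
      by (auto simp: UNIV_bit)
    then show ?thesis
      by (simp add: pmf_map measure_measure_pmf_finite j_def)
  qed
  have snd: "pmf (map_pmf snd J) y = j 0 y + j 1 y" for y
  proof -
    have "snd -` {y} = {(0 :: bit, y), (1, y)}"
      by (auto simp: UNIV_bit)
    then show ?thesis
      by (simp add: pmf_map measure_measure_pmf_finite j_def)
  qed
  show ?thesis
    unfolding mutual_info_eq_sum fst snd sum_bit_prod by (simp add: j_def)
qed

lemma expectation_hamming_bit:
  fixes J :: "(bit \<times> bit) pmf"
  shows "measure_pmf.expectation J (\<lambda>(x, y). hamming x y) = pmf J (0, 1) + pmf J (1, 0)"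
proof -
  have "measure_pmf.expectation J (\<lambda>(x, y). hamming x y)
      = (\<Sum>z\<in>UNIV. (case z of (x, y) \<Rightarrow> hamming x y) * pmf J z)"
    by (rule integral_measure_pmf_real[where A = UNIV]) auto
  also have "\<dots> = (\<Sum>(x, y)\<in>UNIV. hamming x y * pmf J (x, y))"
    by (simp add: split_beta')
  finally show ?thesis
    unfolding sum_bit_prod by (simp add: hamming_def)
qed

lemma log_2_ge: "0 < x \<Longrightarrow> log 2 x \<ge> (1 - 1 / x) / ln 2" for x :: real
  using ln_le_minus_one[of "1 / x"] by (simp add: log_def ln_div divide_right_mono)

text \<open>Read \<open>j / q\<close> as the true backward probability of a source symbol given an
  output symbol of probability \<open>q\<close>, and \<open>c\<close> as a guess for it. The bound
  is the tangent inequality for the logarithm at their ratio. Its correction is linear in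
  \<open>j\<close> and \<open>q\<close>, so that corrections can be summed and cancelled.\<close>

lemma gibbs_term:
  fixes j P q c :: real
  assumes "0 \<le> j" "j \<le> q" "0 < P" "0 < c"
  shows "j * log 2 (j / (P * q)) \<ge> j * log 2 (c / P) + (j - q * c) / ln 2"
proof (cases "j = 0")
  case True
  then show ?thesis
    using assms by (simp add: divide_nonneg_pos)
next
  case False
  then have j: "j > 0" "q > 0"
    using assms by auto
  have "log 2 (j / (P * q)) - log 2 (c / P) = log 2 (j / (q * c))"
    using assms j by (simp add: log_divide log_mult)
  also have "\<dots> \<ge> (1 - q * c / j) / ln 2"
    using log_2_ge[of "j / (q * c)"] assms j by simp
  finally have "j * (log 2 (j / (P * q)) - log 2 (c / P)) \<ge> j * ((1 - q * c / j) / ln 2)"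
    using j by (intro mult_left_mono) auto
  also have "j * ((1 - q * c / j) / ln 2) = (j - q * c) / ln 2"
    using j by (simp add: field_simps)
  finally show ?thesis
    by (simp add: algebra_simps)
qed

text \<open>The true backward channel is compared with the binary symmetric channel of crossover
  probability \<open>d\<close>, which is the backward channel at the optimum.\<close>

lemma mutual_info_ge:
  fixes J :: "(bit \<times> bit) pmf"
  assumes p: "pmf J (0, 0) + pmf J (0, 1) = p" "pmf J (1, 0) + pmf J (1, 1) = 1 - p"
    and d: "0 < d" "d < p" "p \<le> 1 / 2"
    and dist: "measure_pmf.expectation J (\<lambda>(x, y). hamming x y) \<le> d"
  shows "mutual_info J \<ge> binary_entropy p - binary_entropy d"
proof -
  define j where "j = (\<lambda>x y. pmf J (x, y))"
  note nn = pmf_nonneg[of J]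
  have m: "j 0 0 + j 0 1 = p" "j 1 0 + j 1 1 = 1 - p"
    using p by (simp_all add: j_def)
  define E where "E = j 0 1 + j 1 0"
  have mi: "mutual_info J =
    (j 0 0 * log 2 (j 0 0 / ((j 0 0 + j 0 1) * (j 0 0 + j 1 0))) +
     j 0 1 * log 2 (j 0 1 / ((j 0 0 + j 0 1) * (j 0 1 + j 1 1)))) +
    (j 1 0 * log 2 (j 1 0 / ((j 1 0 + j 1 1) * (j 0 0 + j 1 0))) +
     j 1 1 * log 2 (j 1 1 / ((j 1 0 + j 1 1) * (j 0 1 + j 1 1))))"
    by (simp only: mutual_info_bit j_def)
  have E: "E \<le> d"
    using dist by (simp add: expectation_hamming_bit E_def j_def)
  have "j 0 0 * log 2 (j 0 0 / (p * (j 0 0 + j 1 0))) \<ge>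
      j 0 0 * log 2 ((1 - d) / p) + (j 0 0 - (j 0 0 + j 1 0) * (1 - d)) / ln 2"
    using d nn by (intro gibbs_term) (auto simp: j_def)
  moreover have "j 0 1 * log 2 (j 0 1 / (p * (j 0 1 + j 1 1))) \<ge>
      j 0 1 * log 2 (d / p) + (j 0 1 - (j 0 1 + j 1 1) * d) / ln 2"
    using d nn by (intro gibbs_term) (auto simp: j_def)
  moreover have "j 1 0 * log 2 (j 1 0 / ((1 - p) * (j 0 0 + j 1 0))) \<ge>
      j 1 0 * log 2 (d / (1 - p)) + (j 1 0 - (j 0 0 + j 1 0) * d) / ln 2"
    using d nn by (intro gibbs_term) (auto simp: j_def)
  moreover have "j 1 1 * log 2 (j 1 1 / ((1 - p) * (j 0 1 + j 1 1))) \<ge>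
      j 1 1 * log 2 ((1 - d) / (1 - p)) + (j 1 1 - (j 0 1 + j 1 1) * (1 - d)) / ln 2"
    using d nn by (intro gibbs_term) (auto simp: j_def)
  ultimately have "mutual_info J \<ge>
      j 0 0 * log 2 ((1 - d) / p) + j 0 1 * log 2 (d / p) +
      (j 1 0 * log 2 (d / (1 - p)) + j 1 1 * log 2 ((1 - d) / (1 - p))) +
      ((j 0 0 - (j 0 0 + j 1 0) * (1 - d)) + (j 0 1 - (j 0 1 + j 1 1) * d) +
      ((j 1 0 - (j 0 0 + j 1 0) * d) + (j 1 1 - (j 0 1 + j 1 1) * (1 - d)))) / ln 2"
    unfolding mi m by (simp add: add_divide_distrib)
  \<comment> \<open>For each output symbol the guessed backward probabilities \<open>d\<close> and
    \<open>1 - d\<close> sum to 1, so the corrections cancel.\<close>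
  also have "(j 0 0 - (j 0 0 + j 1 0) * (1 - d)) + (j 0 1 - (j 0 1 + j 1 1) * d) +
      ((j 1 0 - (j 0 0 + j 1 0) * d) + (j 1 1 - (j 0 1 + j 1 1) * (1 - d))) = 0"
    by (simp add: algebra_simps)
  also have "j 0 0 * log 2 ((1 - d) / p) + j 0 1 * log 2 (d / p) +
      (j 1 0 * log 2 (d / (1 - p)) + j 1 1 * log 2 ((1 - d) / (1 - p))) =
      (j 0 0 + j 1 1) * log 2 (1 - d) + E * log 2 d - (j 0 0 + j 0 1) * log 2 p
       - (j 1 0 + j 1 1) * log 2 (1 - p)"
    using d by (simp add: log_divide E_def algebra_simps)
  also have "\<dots> = (1 - E) * log 2 (1 - d) + E * log 2 d + binary_entropy p"
  proof -
    have "j 0 0 + j 1 1 = 1 - E"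
      using m by (simp add: E_def)
    then show ?thesis
      using m by (simp add: binary_entropy_def)
  qed
  finally have "mutual_info J \<ge> (1 - E) * log 2 (1 - d) + E * log 2 d + binary_entropy p"
    by simp
  \<comment> \<open>Here \<open>d\<close> is below 1/2, so the slope is nonnegative and
    \<open>E\<close> may be replaced by its upper bound \<open>d\<close>.\<close>
  moreover have "E * (log 2 (1 - d) - log 2 d) \<le> d * (log 2 (1 - d) - log 2 d)"
    using d E by (intro mult_right_mono) auto
  ultimately show ?thesis
    by (simp add: binary_entropy_def algebra_simps)
qed

lemma bit_pmf_exists:
  assumes "0 \<le> t" "t \<le> (1::real)"
  obtains Q :: "bit pmf" where "pmf Q 0 = t" "pmf Q 1 = 1 - t"
proof
  define Q where "Q = map_pmf (\<lambda>b. if b then 0 else (1::bit)) (bernoulli_pmf t)"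
  have inj: "inj (\<lambda>b. if b then 0 else (1::bit))"
    by (auto simp: inj_on_def)
  show "pmf Q 0 = t" "pmf Q 1 = 1 - t"
    using pmf_map_inj'[OF inj, of "bernoulli_pmf t" True]
      pmf_map_inj'[OF inj, of "bernoulli_pmf t" False] assms by (simp_all add: Q_def)
qed

lemma rate_distortion_bit:
  assumes P: "pmf P (0::bit) = p" "pmf P 1 = 1 - p"
    and d: "0 < d" "d < p" "p \<le> 1 / 2"
  shows "rate_distortion P d = binary_entropy p - binary_entropy d"
  unfolding rate_distortion_def
proof (rule cInf_eq_minimum)
  \<comment> \<open>The output probability of 0 from which a binary symmetric channel with crossover
    \<open>d\<close>, run from output to source, reproduces \<open>p\<close>.\<close>
  define q where "q = (p - d) / (1 - 2 * d)"
  have q: "0 < q" "q < 1"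
    using d by (simp_all add: q_def)
  have "q * (1 - 2 * d) = p - d"
    using d by (simp add: q_def)
  then have qp: "q * (1 - d) + (1 - q) * d = p" "q * d + (1 - q) * (1 - d) = 1 - p"
    by (simp_all add: algebra_simps)
  have pos: "0 < q * (1 - d)" "0 < (1 - q) * d" "0 < q * d" "0 < (1 - q) * (1 - d)"
    using q d by simp_all
  have le_sum: "a + b = c \<Longrightarrow> 0 < b \<Longrightarrow> a \<le> c" for a b c :: real
    by simp
  have "0 < p" "0 < 1 - p"
    using d by simp_all
  note le = this le_sum[OF qp(1) pos(2)] le_sum[OF qp(2) pos(4)]
  \<comment> \<open>Bayes' rule turns the backward channel into the forward kernels
    \<open>W0\<close> and \<open>W1\<close>.\<close>
  have "0 \<le> q * (1 - d) / p" "q * (1 - d) / p \<le> 1"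
    using le pos by simp_all
  then obtain W0 :: "bit pmf" where W0: "pmf W0 0 = q * (1 - d) / p" "pmf W0 1 = 1 - q * (1 - d) / p"
    by (rule bit_pmf_exists)
  have "0 \<le> q * d / (1 - p)" "q * d / (1 - p) \<le> 1"
    using le pos by simp_all
  then obtain W1 :: "bit pmf" where W1: "pmf W1 0 = q * d / (1 - p)" "pmf W1 1 = 1 - q * d / (1 - p)"
    by (rule bit_pmf_exists)
  define W where "W x = (if x = 0 then W0 else W1)" for x :: bit
  define J where "J = joint_pmf P W"
  have minus: "p - q * (1 - d) = (1 - q) * d" "(1 - p) - q * d = (1 - q) * (1 - d)"
    using qp by (metis add_diff_cancel_left')+
  have mul: "c * (a / c) = a" "c * (1 - a / c) = c - a" if "0 < c" for a c :: real
    using that by (simp_all add: field_simps)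
  have J: "pmf J (0, 0) = q * (1 - d)" "pmf J (0, 1) = (1 - q) * d"
    "pmf J (1, 0) = q * d" "pmf J (1, 1) = (1 - q) * (1 - d)"
    by (simp_all only: J_def pmf_joint_pmf P W_def W0 W1 mul minus le(1,2)
      simp_thms if_True if_False one_neq_zero)
  have "(1 - q) * d + q * d = d" "q * (1 - d) + q * d = q" "(1 - q) * d + (1 - q) * (1 - d) = 1 - q"
    by (simp_all add: algebra_simps)
  note J' = J this qp
  have "mutual_info J = q * (1 - d) * log 2 ((1 - d) / p) + (1 - q) * d * log 2 (d / p)
      + (q * d * log 2 (d / (1 - p)) + (1 - q) * (1 - d) * log 2 ((1 - d) / (1 - p)))"
    unfolding mutual_info_bit J' using q d by simp
  also have "\<dots> = (q * (1 - d) + (1 - q) * (1 - d)) * log 2 (1 - d) + ((1 - q) * d + q * d) * log 2 d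
     - (q * (1 - d) + (1 - q) * d) * log 2 p - (q * d + (1 - q) * (1 - d)) * log 2 (1 - p)"
    using d by (simp add: log_divide algebra_simps)
  also have "\<dots> = (1 - d) * log 2 (1 - d) + d * log 2 d - p * log 2 p - (1 - p) * log 2 (1 - p)"
    unfolding qp J' by (simp add: algebra_simps)
  finally have "mutual_info J = binary_entropy p - binary_entropy d"
    by (simp add: binary_entropy_def)
  moreover have "measure_pmf.expectation J (\<lambda>(x, y). hamming x y) \<le> d"
    unfolding expectation_hamming_bit J' by simp
  ultimately show "binary_entropy p - binary_entropy d \<in> {mutual_info (joint_pmf P W) | W.
            measure_pmf.expectation (joint_pmf P W) (\<lambda>(x, y). hamming x y) \<le> d}"
    by (force simp: J_def)
next
  fix r
  assume "r \<in> {mutual_info (joint_pmf P W) | W.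
            measure_pmf.expectation (joint_pmf P W) (\<lambda>(x, y). hamming x y) \<le> d}"
  then obtain W where W: "r = mutual_info (joint_pmf P W)"
    "measure_pmf.expectation (joint_pmf P W) (\<lambda>(x, y). hamming x y) \<le> d"
    by auto
  have "pmf (W x) 0 + pmf (W x) 1 = 1" for x
    using sum_pmf_eq_1[of UNIV "W x"] by (simp add: sum_bit)
  then show "binary_entropy p - binary_entropy d \<le> r"
    unfolding W using W(2) d P
    by (intro mutual_info_ge) (simp_all add: pmf_joint_pmf flip: distrib_left)
qed

section \<open>Binomial coefficients and coverings\<close>

text \<open>Successive terms of m^i / i! have ratio m / (i + 1), so they increase up to i = m and
  decrease afterwards. The two inductions start at \<open>m\<close> and move away from it in either
  direction.\<close>

lemma fact_mult_power_le: "fact m * m ^ i \<le> (fact i * m ^ m :: nat)"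
proof (cases "i \<le> m")
  case True
  then show ?thesis
  proof (induction rule: inc_induct)
    case (step i)
    have "m * (fact m * m ^ i) \<le> Suc i * (fact i * m ^ m)"
      using step.IH by (simp add: algebra_simps)
    also have "\<dots> \<le> m * (fact i * m ^ m)"
      using step by (intro mult_right_mono) auto
    finally show ?case
      using step by simp
  qed simp
next
  case False
  then have "m \<le> i"
    by simp
  then show ?thesis
  proof (induction rule: dec_induct)
    case (step k)
    have "fact m * m ^ Suc k = (fact m * m ^ k) * m"
      by simp
    also have "\<dots> \<le> (fact k * m ^ m) * Suc k"
      using step.IH step.hyps(1) by (intro mult_le_mono[of _ _ m]) simp_all
    also have "\<dots> = fact (Suc k) * m ^ m"
      by (simp add: algebra_simps)
    finally show ?case .
  qed simp
qed

text \<open>The binomial law with parameter k / n has its mode at \<open>k\<close>. The factorials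
  are multiplied out, and the previous lemma is used once for the successes and once for the
  failures.\<close>

lemma binomial_mode:
  assumes "k \<le> n" "i \<le> n"
  shows "(n choose i) * k ^ i * (n - k) ^ (n - i) \<le> (n choose k) * k ^ k * (n - k) ^ (n - k)"
proof -
  have "fact i * fact (n - i) * (fact k * fact (n - k)) * ((n choose i) * k ^ i * (n - k) ^ (n - i))
      = (fact i * fact (n - i) * (n choose i)) * ((fact k * k ^ i) * (fact (n - k) * (n - k) ^ (n - i)))"
    by (simp only: mult_ac)
  also have "\<dots> \<le> fact n * ((fact i * k ^ k) * (fact (n - i) * (n - k) ^ (n - k)))"
    using assms by (intro mult_mono fact_mult_power_le) (auto simp: binomial_fact_lemma)
  also have "\<dots> = (fact k * fact (n - k) * (n choose k)) * ((fact i * k ^ k) * (fact (n - i) * (n - k) ^ (n - k)))"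
    using assms by (simp add: binomial_fact_lemma)
  also have "\<dots> = fact i * fact (n - i) * (fact k * fact (n - k)) * ((n choose k) * k ^ k * (n - k) ^ (n - k))"
    by (simp only: mult_ac)
  finally show ?thesis
    by simp
qed

lemma choose_times_powers_le:
  fixes \<theta> :: real
  assumes "0 \<le> \<theta>" "\<theta> \<le> 1" "k \<le> n"
  shows "real (n choose k) * \<theta> ^ k * (1 - \<theta>) ^ (n - k) \<le> 1"
proof -
  have "real (n choose k) * \<theta> ^ k * (1 - \<theta>) ^ (n - k)
      \<le> (\<Sum>i\<le>n. real (n choose i) * \<theta> ^ i * (1 - \<theta>) ^ (n - i))"
    using assms by (intro member_le_sum) auto
  also have "\<dots> = 1"
    using binomial_ring[of \<theta> "1 - \<theta>" n] by simp
  finally show ?thesis .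
qed

text \<open>The expansion of (k + (n - k))^n has n + 1 terms, the largest of which is the one at
  \<open>k\<close>.\<close>

lemma choose_times_powers_ge:
  assumes "k \<le> n"
  shows "real (n choose k) * real k ^ k * real (n - k) ^ (n - k) * (real n + 1) \<ge> real n ^ n"
proof -
  have "n ^ n = (k + (n - k)) ^ n"
    using assms by simp
  also have "\<dots> = (\<Sum>i\<le>n. (n choose i) * k ^ i * (n - k) ^ (n - i))"
    by (simp only: binomial of_nat_id)
  also have "\<dots> \<le> (\<Sum>i\<le>n. (n choose k) * k ^ k * (n - k) ^ (n - k))"
    using assms by (intro sum_mono binomial_mode) auto
  also have "\<dots> = (n choose k) * k ^ k * (n - k) ^ (n - k) * (n + 1)"
    by simp
  finally have "real (n ^ n) \<le> real ((n choose k) * k ^ k * (n - k) ^ (n - k) * (n + 1))"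
    by (rule of_nat_mono)
  then show ?thesis
    by (simp add: algebra_simps)
qed

text \<open>Under the binomial law with parameter k / n the value \<open>k\<close> has probability
  between 1 / (n + 1) and 1; both bounds are the logarithm of this.\<close>

lemma log_choose_bounds:
  assumes "0 < k" "k < n"
  shows "log 2 (real (n choose k)) \<le> n * binary_entropy (k / n)"
    and "log 2 (real (n choose k)) \<ge> n * binary_entropy (k / n) - log 2 (real n + 1)"
proof -
  define \<theta> where "\<theta> = real k / real n"
  have \<theta>: "0 < \<theta>" "\<theta> < 1" "n * \<theta> = k" "n * (1 - \<theta>) = real (n - k)"
    using assms by (auto simp: \<theta>_def field_simps of_nat_diff)
  have pos: "real (n choose k) > 0"
    using assms by simp
  have logs: "log 2 (real (n choose k) * \<theta> ^ k * (1 - \<theta>) ^ (n - k))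
      = log 2 (real (n choose k)) + (real k * log 2 \<theta> + real (n - k) * log 2 (1 - \<theta>))"
    using \<theta>(1,2) pos by (simp add: log_mult log_nat_power)
  have ent: "real k * log 2 \<theta> + real (n - k) * log 2 (1 - \<theta>) = - n * binary_entropy \<theta>"
    unfolding \<theta>(3,4)[symmetric] binary_entropy_def by (simp add: algebra_simps)
  have "log 2 (real (n choose k) * \<theta> ^ k * (1 - \<theta>) ^ (n - k)) \<le> log 2 1"
  proof (rule log_mono)
    show "0 < real (n choose k) * \<theta> ^ k * (1 - \<theta>) ^ (n - k)"
      using \<theta>(1,2) pos by simp
    show "real (n choose k) * \<theta> ^ k * (1 - \<theta>) ^ (n - k) \<le> 1"
      using \<theta>(1,2) assms by (intro choose_times_powers_le) auto
  qed simp
  then show "log 2 (real (n choose k)) \<le> n * binary_entropy (k / n)"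
    unfolding logs ent \<theta>_def[symmetric] by simp
  have "real n ^ n = real n ^ k * real n ^ (n - k)"
    using assms by (simp flip: power_add)
  then have "real n ^ n * 1 \<le> real n ^ n * (real (n choose k) * \<theta> ^ k * (1 - \<theta>) ^ (n - k) * (real n + 1))"
    using choose_times_powers_ge[of k n] assms unfolding \<theta>(3,4)[symmetric]
    by (simp add: power_mult_distrib mult_ac)
  then have "1 \<le> real (n choose k) * \<theta> ^ k * (1 - \<theta>) ^ (n - k) * (real n + 1)"
    using assms by (subst (asm) mult_le_cancel_left_pos) auto
  then have "log 2 1 \<le> log 2 (real (n choose k) * \<theta> ^ k * (1 - \<theta>) ^ (n - k) * (real n + 1))"
    by (intro log_mono) simp_all
  also have "\<dots> = log 2 (real (n choose k) * \<theta> ^ k * (1 - \<theta>) ^ (n - k)) + log 2 (real n + 1)"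
    using \<theta>(1,2) pos by (subst log_mult) simp_all
  finally show "log 2 (real (n choose k)) \<ge> n * binary_entropy (k / n) - log 2 (real n + 1)"
    unfolding logs ent \<theta>_def[symmetric] by simp
qed

lemma isCont_binary_entropy: "0 < t \<Longrightarrow> t < 1 \<Longrightarrow> isCont binary_entropy t"
  unfolding binary_entropy_def by (auto intro!: continuous_intros)

text \<open>The upper index is a general sequence because the covering code also needs the
  coefficients for the zeros and for the ones of a codeword separately.\<close>

lemma log_choose_tendsto:
  fixes N k :: "nat \<Rightarrow> nat"
  assumes N: "filterlim N at_top sequentially"
    and k: "(\<lambda>n. real (k n) / real (N n)) \<longlonglongrightarrow> t" and t: "0 < t" "t < 1"
  shows "(\<lambda>n. log 2 (real (N n choose k n)) / real (N n)) \<longlonglongrightarrow> binary_entropy t"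
proof (rule real_tendsto_sandwich)
  have ev: "\<forall>\<^sub>F n in sequentially. 0 < k n \<and> k n < N n"
    using order_tendstoD(1)[OF k t(1)] order_tendstoD(2)[OF k t(2)]
    by eventually_elim (auto simp: zero_less_divide_iff)
  show "\<forall>\<^sub>F n in sequentially. binary_entropy (k n / N n) - log 2 (real (N n) + 1) / N n
      \<le> log 2 (real (N n choose k n)) / real (N n)"
    using ev
  proof eventually_elim
    case (elim n)
    then have "(N n * binary_entropy (k n / N n) - log 2 (real (N n) + 1)) / N n
      \<le> log 2 (real (N n choose k n)) / real (N n)"
      by (intro divide_right_mono log_choose_bounds) auto
    then show ?case
      using elim by (simp add: diff_divide_distrib)
  qed
  show "\<forall>\<^sub>F n in sequentially. log 2 (real (N n choose k n)) / real (N n) \<le> binary_entropy (k n / N n)"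
    using ev
  proof eventually_elim
    case (elim n)
    then show ?case
      using log_choose_bounds(1)[of "k n" "N n"] by (simp add: divide_le_eq mult_ac)
  qed
  have H: "(\<lambda>n. binary_entropy (k n / N n)) \<longlonglongrightarrow> binary_entropy t"
    using isCont_binary_entropy[OF t] k by (rule isCont_tendsto_compose)
  then show "(\<lambda>n. binary_entropy (k n / N n)) \<longlonglongrightarrow> binary_entropy t" .
  have "(\<lambda>n. log 2 (real n + 1) / real n) \<longlonglongrightarrow> 0"
    by real_asymp
  from tendsto_diff[OF H filterlim_compose[OF this N]]
  show "(\<lambda>n. binary_entropy (k n / N n) - log 2 (real (N n) + 1) / N n) \<longlonglongrightarrow> binary_entropy t"
    by simp
qed

text \<open>Both sides count the pairs (A, B) with card B = m, card (B - A) = j and card (A - B) =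
  l, once starting from B and once from A. The computation reduces either side to the same
  multinomial coefficient.\<close>

lemma multinomial_exchange:
  assumes "m \<le> n" "j \<le> m" "l \<le> n - m"
  shows "(n choose m) * (m choose j) * ((n - m) choose l) =
    (n choose (m - j + l)) * ((m - j + l) choose l) * ((n - (m - j + l)) choose j)"
proof -
  define k where "k = m - j + l"
  have k: "k \<le> n" "l \<le> k" "j \<le> n - k" "k - l = m - j" "n - k - j = n - m - l"
    using assms by (auto simp: k_def)
  let ?c = "fact j * fact (m - j) * fact l * fact (n - m - l) :: nat"
  have "?c * ((n choose m) * (m choose j) * ((n - m) choose l)) =
     (n choose m) * (fact j * fact (m - j) * (m choose j)) * (fact l * fact (n - m - l) * ((n - m) choose l))"
    by (simp only: mult_ac)
  also have "\<dots> = fact m * fact (n - m) * (n choose m)"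
    unfolding binomial_fact_lemma[OF assms(2)] binomial_fact_lemma[OF assms(3)] by (simp only: mult_ac)
  also have "\<dots> = fact k * fact (n - k) * (n choose k)"
    using assms k by (simp add: binomial_fact_lemma)
  also have "\<dots> = (n choose k) * (fact l * fact (k - l) * (k choose l)) * (fact j * fact (n - k - j) * ((n - k) choose j))"
    unfolding binomial_fact_lemma[OF k(2)] binomial_fact_lemma[OF k(3)] by (simp only: mult_ac)
  also have "\<dots> = ?c * ((n choose k) * (k choose l) * ((n - k) choose j))"
    unfolding k by (simp only: mult_ac)
  finally show ?thesis
    by (simp add: k_def)
qed

text \<open>By double counting, some \<open>y\<close> covers at least the fraction
  \<open>\<nu> / card Y\<close> of the points still uncovered. Adding such a \<open>y\<close> in
  each of \<open>M\<close> rounds gives the geometric decay.\<close>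

lemma greedy_cover_step:
  fixes N :: "'b \<Rightarrow> 'a set" and \<nu> :: real
  assumes "finite X" "finite Y" "Y \<noteq> {}"
    and deg: "\<And>x. x \<in> X \<Longrightarrow> real (card {y \<in> Y. x \<in> N y}) \<ge> \<nu>"
  shows "\<exists>C \<subseteq> Y. card C \<le> M \<and> real (card (X - (\<Union>y\<in>C. N y))) \<le> real (card X) * (1 - \<nu> / card Y) ^ M"
proof (induction M)
  case 0
  then show ?case
    by (intro exI[of _ "{}"]) auto
next
  case (Suc M)
  then obtain C where C: "C \<subseteq> Y" "card C \<le> M"
    "real (card (X - (\<Union>y\<in>C. N y))) \<le> real (card X) * (1 - \<nu> / card Y) ^ M"
    by auto
  define V where "V = X - (\<Union>y\<in>C. N y)"
  have V: "finite V" "V \<subseteq> X"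
    using assms by (auto simp: V_def)
  have cardY: "real (card Y) > 0"
    using assms by (simp add: card_gt_0_iff)
  have "\<exists>y\<in>Y. real (card (V \<inter> N y)) \<ge> \<nu> * card V / card Y"
  proof (rule ccontr)
    assume "\<not> ?thesis"
    then have "(\<Sum>y\<in>Y. real (card (V \<inter> N y))) < (\<Sum>y\<in>Y. \<nu> * card V / card Y)"
      using assms by (intro sum_strict_mono) (auto simp: not_le)
    also have "\<dots> = \<nu> * card V"
      using cardY by simp
    also have "\<dots> \<le> (\<Sum>x\<in>V. real (card {y \<in> Y. x \<in> N y}))"
      using sum_bounded_below[of V \<nu> "\<lambda>x. real (card {y \<in> Y. x \<in> N y})"] V deg
      by (auto simp: mult_ac)
    also have "\<dots> = (\<Sum>x\<in>V. \<Sum>y\<in>Y. of_bool (x \<in> N y))"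
      using assms by (intro sum.cong) (auto simp: sum.If_cases of_bool_def Int_def)
    also have "\<dots> = (\<Sum>y\<in>Y. \<Sum>x\<in>V. of_bool (x \<in> N y))"
      by (rule sum.swap)
    also have "\<dots> = (\<Sum>y\<in>Y. real (card (V \<inter> N y)))"
      using V by (intro sum.cong) (auto simp: sum.If_cases of_bool_def Int_def)
    finally show False
      by simp
  qed
  then obtain y where y: "y \<in> Y" "real (card (V \<inter> N y)) \<ge> \<nu> * card V / card Y"
    by auto
  \<comment> \<open>The degree bound gives \<open>\<nu> \<le> card Y\<close> only when there is a
    point to apply it to, hence the separate empty case below.\<close>
  have fac: "0 \<le> 1 - \<nu> / card Y" if "X \<noteq> {}"
  proof -
    obtain x where "x \<in> X"
      using \<open>X \<noteq> {}\<close> by auto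
    then have "\<nu> \<le> real (card {y \<in> Y. x \<in> N y})"
      by (rule deg)
    also have "\<dots> \<le> real (card Y)"
      using assms by (intro of_nat_mono card_mono) auto
    finally show ?thesis
      using cardY by simp
  qed
  have "real (card (X - (\<Union>y\<in>insert y C. N y))) = real (card (V - V \<inter> N y))"
    by (intro arg_cong[where f = "\<lambda>S. real (card S)"]) (auto simp: V_def)
  also have "\<dots> = real (card V) - real (card (V \<inter> N y))"
    using V by (simp add: card_Diff_subset of_nat_diff card_mono)
  also have "\<dots> \<le> real (card V) * (1 - \<nu> / card Y)"
    using y by (simp add: algebra_simps)
  also have "\<dots> \<le> real (card X) * (1 - \<nu> / card Y) ^ Suc M"
  proof (cases "X = {}")
    case False
    have "real (card V) * (1 - \<nu> / card Y) \<le> real (card X) * (1 - \<nu> / card Y) ^ M * (1 - \<nu> / card Y)"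
      using C(3) fac[OF False] by (intro mult_right_mono) (auto simp: V_def)
    then show ?thesis
      by (simp add: mult_ac)
  qed (use V in auto)
  finally show ?case
    using C y assms finite_subset[OF C(1)]
    by (intro exI[of _ "insert y C"]) (auto simp: card_insert_if)
qed

text \<open>With more than ln (card X) * card Y / \<nu> rounds, fewer than one point is left
  uncovered, hence none.\<close>

lemma greedy_cover:
  fixes N :: "'b \<Rightarrow> 'a set" and \<nu> :: real
  assumes "finite X" "X \<noteq> {}" "finite Y" "Y \<noteq> {}" "0 < \<nu>"
    and deg: "\<And>x. x \<in> X \<Longrightarrow> real (card {y \<in> Y. x \<in> N y}) \<ge> \<nu>"
  shows "\<exists>C \<subseteq> Y. X \<subseteq> (\<Union>y\<in>C. N y) \<and> real (card C) \<le> ln (real (card X)) * card Y / \<nu> + 1"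
proof -
  define L where "L = ln (real (card X)) * card Y / \<nu>"
  have cardX: "real (card X) \<ge> 1"
    using assms by (simp add: Suc_le_eq card_gt_0_iff)
  have cardY: "real (card Y) > 0"
    using assms by (simp add: card_gt_0_iff)
  have L: "L \<ge> 0"
    using cardX cardY assms by (simp add: L_def)
  define M where "M = Suc (nat \<lfloor>L\<rfloor>)"
  have M: "L < M" "M \<le> L + 1"
    using L by (simp_all add: M_def) linarith+
  obtain C where C: "C \<subseteq> Y" "card C \<le> M"
    "real (card (X - (\<Union>y\<in>C. N y))) \<le> real (card X) * (1 - \<nu> / card Y) ^ M"
    using greedy_cover_step[OF assms(1,3,4) deg, of M] by auto
  obtain x where "x \<in> X"
    using \<open>X \<noteq> {}\<close> by auto
  then have "\<nu> \<le> real (card {y \<in> Y. x \<in> N y})"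
    by (rule deg)
  also have "\<dots> \<le> real (card Y)"
    using assms by (intro of_nat_mono card_mono) auto
  finally have "0 \<le> 1 - \<nu> / card Y"
    using cardY by simp
  then have "(1 - \<nu> / card Y) ^ M \<le> exp (- \<nu> / card Y) ^ M"
    using exp_ge_add_one_self[of "- \<nu> / card Y"] by (intro power_mono) auto
  also have "\<dots> = exp (- (M * \<nu> / card Y))"
    by (simp flip: exp_of_nat_mult)
  also have "\<dots> < exp (- ln (real (card X)))"
    using M(1) cardY assms by (simp add: L_def field_simps)
  also have "\<dots> = 1 / real (card X)"
    using cardX by (simp add: exp_minus inverse_eq_divide)
  finally have "real (card X) * (1 - \<nu> / card Y) ^ M < 1"
    using cardX by (simp add: field_simps)
  then have "card (X - (\<Union>y\<in>C. N y)) = 0"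
    using C(3) by linarith
  then have "X \<subseteq> (\<Union>y\<in>C. N y)"
    using assms by simp
  then show ?thesis
    using C M by (intro exI[of _ C]) (auto simp: L_def)
qed

lemma card_subsets_at_offset:
  assumes "A \<subseteq> {..<n}" "card A = k" "l \<le> k"
  shows "card {B. B \<subseteq> {..<n} \<and> card (A - B) = l \<and> card (B - A) = j} = (k choose l) * ((n - k) choose j)"
proof -
  have fin: "finite A"
    using assms finite_subset by blast
  have "bij_betw (\<lambda>B. (A - B, B - A)) {B. B \<subseteq> {..<n} \<and> card (A - B) = l \<and> card (B - A) = j}
    ({S. S \<subseteq> A \<and> card S = l} \<times> {T. T \<subseteq> {..<n} - A \<and> card T = j})"
  proof (rule bij_betw_byWitness[where f' = "\<lambda>(S, T). (A - S) \<union> T"])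
    show "(\<lambda>(S, T). (A - S) \<union> T) ` ({S. S \<subseteq> A \<and> card S = l} \<times> {T. T \<subseteq> {..<n} - A \<and> card T = j})
      \<subseteq> {B. B \<subseteq> {..<n} \<and> card (A - B) = l \<and> card (B - A) = j}"
    proof clarsimp
      fix S T
      assume "S \<subseteq> A" "T \<subseteq> {..<n} - A" 
      then have "A - (A - S \<union> T) = S" "A - S \<union> T - A = T"
        by auto
      then show "A - S \<subseteq> {..<n} \<and> T \<subseteq> {..<n} \<and> card (A - (A - S \<union> T)) = card S \<and> card (A - S \<union> T - A) = card T"
        using \<open>T \<subseteq> {..<n} - A\<close> assms by auto
    qed
  qed auto
  then have "card {B. B \<subseteq> {..<n} \<and> card (A - B) = l \<and> card (B - A) = j} =
    card {S. S \<subseteq> A \<and> card S = l} * card {T. T \<subseteq> {..<n} - A \<and> card T = j}"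
    by (simp add: bij_betw_same_card card_cartesian_product)
  then show ?thesis
    using assms fin by (simp add: n_subsets card_Diff_subset)
qed

lemma card_eq_offset:
  assumes "finite A" "finite B"
  shows "card A + card (B - A) = card B + card (A - B)"
proof -
  have "card A + card (B - A) = card (A \<union> (B - A))" "card B + card (A - B) = card (B \<union> (A - B))"
    using assms by (intro card_Un_disjoint[symmetric]; auto)+
  then show ?thesis
    by (simp add: Un_commute)
qed

text \<open>The greedy bound involves \<open>card Y / \<nu>\<close>. By the exchange identity this
  equals the size of the covered layer divided by the number of its points that one centre covers,
  the least conceivable number of centres. Greedy choice therefore loses only the factor n +
  1.\<close>

lemma layer_cover:
  assumes "m \<le> n" "j \<le> m" "l \<le> n - m"
  shows "\<exists>C \<subseteq> {B. B \<subseteq> {..<n} \<and> card B = m}. C \<noteq> {} \<and>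
    (\<forall>A. A \<subseteq> {..<n} \<and> card A = m - j + l \<longrightarrow> (\<exists>B\<in>C. card (A - B) + card (B - A) = j + l)) \<and>
    real (card C) \<le> (real n + 1) * (real (n choose (m - j + l)) / (real (m choose j) * real ((n - m) choose l)))"
proof -
  define k where "k = m - j + l"
  have k: "k \<le> n" "l \<le> k" "j \<le> n - k"
    using assms by (auto simp: k_def)
  define X where "X = {A. A \<subseteq> {..<n} \<and> card A = k}"
  define Y where "Y = {B. B \<subseteq> {..<n} \<and> card B = m}"
  define N where "N B = {A. A \<subseteq> {..<n} \<and> card (A - B) = l \<and> card (B - A) = j}" for B :: "nat set"
  define \<nu> where "\<nu> = real (k choose l) * real ((n - k) choose j)"
  have cX: "card X = n choose k" and cY: "card Y = n choose m"
    using n_subsets[of "{..<n}"] by (auto simp: X_def Y_def)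
  have fin: "finite X" "finite Y"
    by (auto simp: X_def Y_def)
  have "card X > 0" "card Y > 0"
    using cX cY k assms by simp_all
  then have ne: "X \<noteq> {}" "Y \<noteq> {}"
    by auto
  have \<nu>: "\<nu> > 0"
    using k by (simp add: \<nu>_def)
  have deg: "real (card {B \<in> Y. A \<in> N B}) \<ge> \<nu>" if "A \<in> X" for A
  proof -
    have A: "A \<subseteq> {..<n}" "card A = k" "finite A"
      using that finite_subset by (auto simp: X_def)
    have "{B. B \<subseteq> {..<n} \<and> card (A - B) = l \<and> card (B - A) = j} \<subseteq> {B \<in> Y. A \<in> N B}"
    proof clarify
      fix B
      assume B: "B \<subseteq> {..<n}" "l = card (A - B)" "j = card (B - A)"
      then have "card B = m"
        using card_eq_offset[of A B] A assms finite_subset[OF B(1)] by (simp add: k_def)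
      then show "B \<in> Y \<and> A \<in> N B"
        using A B by (auto simp: Y_def N_def)
    qed
    then have "card {B. B \<subseteq> {..<n} \<and> card (A - B) = l \<and> card (B - A) = j} \<le> card {B \<in> Y. A \<in> N B}"
      using fin by (intro card_mono) auto
    then have "(k choose l) * ((n - k) choose j) \<le> card {B \<in> Y. A \<in> N B}"
      using card_subsets_at_offset[of A n k l j] A k by simp
    then show ?thesis
      unfolding \<nu>_def of_nat_mult[symmetric] by (rule of_nat_mono)
  qed
  obtain C where C: "C \<subseteq> Y" "X \<subseteq> (\<Union>B\<in>C. N B)" "real (card C) \<le> ln (real (card X)) * card Y / \<nu> + 1"
    using greedy_cover[of X Y \<nu> N, OF fin(1) ne(1) fin(2) ne(2) \<nu> deg] by auto
  have "ln (real (card X)) \<le> real n"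
  proof -
    have "real (card X) \<le> real (card (Pow {..<n}))"
      by (intro of_nat_mono card_mono) (auto simp: X_def)
    also have "\<dots> = 2 ^ n"
      by (simp add: card_Pow)
    finally have "ln (real (card X)) \<le> ln (2 ^ n)"
      using \<open>card X > 0\<close> by (subst ln_le_cancel_iff) auto
    also have "\<dots> = n * ln 2"
      by (simp add: ln_realpow)
    also have "\<dots> \<le> real n * 1"
      using ln_2_less_1 by (intro mult_left_mono) auto
    finally show ?thesis
      by simp
  qed
  then have "ln (real (card X)) * card Y / \<nu> \<le> real n * (card Y / \<nu>)"
    using \<nu> by (simp add: divide_right_mono mult_right_mono)
  \<comment> \<open>This absorbs the additive 1 of the greedy bound into the factor n + 1.\<close>
  moreover have "1 \<le> card Y / \<nu>"
  proof -
    obtain A where "A \<in> X"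
      using ne by auto
    then have "\<nu> \<le> real (card {B \<in> Y. A \<in> N B})"
      by (rule deg)
    also have "\<dots> \<le> real (card Y)"
      using fin by (intro of_nat_mono card_mono) auto
    finally show ?thesis
      using \<nu> by simp
  qed
  ultimately have "real (card C) \<le> (real n + 1) * (card Y / \<nu>)"
    using C(3) unfolding distrib_right by linarith
  moreover have "card Y / \<nu> = real (n choose k) / (real (m choose j) * real ((n - m) choose l))"
  proof -
    have "real ((n choose m) * (m choose j) * ((n - m) choose l)) = real ((n choose k) * (k choose l) * ((n - k) choose j))"
      using multinomial_exchange[OF assms] by (simp add: k_def)
    then show ?thesis
      using assms k unfolding cY by (subst frac_eq_eq) (auto simp: \<nu>_def mult_ac)
  qed
  ultimately have "real (card C) \<le> (real n + 1) * (real (n choose k) / (real (m choose j) * real ((n - m) choose l)))"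
    by simp
  moreover have "\<exists>B\<in>C. card (A - B) + card (B - A) = j + l" if "A \<in> X" for A
  proof -
    obtain B where "B \<in> C" "A \<in> N B"
      using C(2) \<open>A \<in> X\<close> by auto
    then show ?thesis
      by (intro bexI[of _ B]) (auto simp: N_def)
  qed
  ultimately show ?thesis
    using C(1,2) ne by (intro exI[of _ C]) (auto simp: X_def Y_def k_def)
qed

section \<open>Typical sequences and the converse\<close>

text \<open>Sequences become subsets of \<open>{..<n}\<close>, so that layers and coverings can be
  counted by binomial coefficients.\<close>

definition zeros :: "nat \<Rightarrow> (nat \<Rightarrow> bit) \<Rightarrow> nat set" where
  "zeros n x = {i. i < n \<and> x i = 0}"

lemma zeros_subset: "zeros n x \<subseteq> {..<n}"
  by (auto simp: zeros_def)

lemma finite_zeros [simp]: "finite (zeros n x)"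
  by (simp add: zeros_def)

lemma card_zeros_le: "card (zeros n x) \<le> n"
  using card_mono[OF _ zeros_subset, of n x] by simp

lemma bij_betw_zeros: "bij_betw (zeros n) (seqs n) (Pow {..<n})"
proof (rule bij_betw_byWitness[where f' = "\<lambda>A. \<lambda>i\<in>{..<n}. if i \<in> A then 0 else 1"])
  show "\<forall>x\<in>seqs n. (\<lambda>i\<in>{..<n}. if i \<in> zeros n x then 0 else 1) = x"
    by (auto simp: seqs_def zeros_def fun_eq_iff PiE_def extensional_def)
  show "zeros n ` seqs n \<subseteq> Pow {..<n}"
    by (auto simp: zeros_def)
qed (auto simp: zeros_def seqs_def split: if_splits)

lemma finite_seqs [simp]: "finite (seqs n :: (nat \<Rightarrow> 'a::finite) set)"
  unfolding seqs_def by (intro finite_PiE) auto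

lemma card_seqs: "card (seqs n :: (nat \<Rightarrow> bit) set) = 2 ^ n"
  using bij_betw_same_card[OF bij_betw_zeros, of n] by (simp add: card_Pow)

lemma seqs_eqI: "x \<in> seqs n \<Longrightarrow> y \<in> seqs n \<Longrightarrow> (\<And>i. i < n \<Longrightarrow> x i = y i) \<Longrightarrow> x = y"
  unfolding seqs_def by (rule PiE_ext) auto

lemma zeros_inj: "x \<in> seqs n \<Longrightarrow> y \<in> seqs n \<Longrightarrow> zeros n x = zeros n y \<Longrightarrow> x = y"
  using bij_betw_zeros[of n] by (auto simp: bij_betw_def inj_on_def)

lemma zeros_surj: "A \<subseteq> {..<n} \<Longrightarrow> \<exists>x\<in>seqs n. zeros n x = A"
  using bij_betw_imp_surj_on[OF bij_betw_zeros, of n] by (metis PowI imageE)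

lemma block_dist_zeros:
  "block_dist n y x = (real (card (zeros n y - zeros n x)) + real (card (zeros n x - zeros n y))) / n"
proof -
  have "{k \<in> {..<n}. y k \<noteq> x k} = (zeros n y - zeros n x) \<union> (zeros n x - zeros n y)"
    by (auto simp: zeros_def)
  moreover have "card \<dots> = card (zeros n y - zeros n x) + card (zeros n x - zeros n y)"
    by (intro card_Un_disjoint) auto
  ultimately have "card {k \<in> {..<n}. y k \<noteq> x k} = card (zeros n y - zeros n x) + card (zeros n x - zeros n y)"
    by (simp only:)
  then show ?thesis
    by (simp add: block_dist_def)
qed

lemma block_utility_zeros:
  fixes U :: "bit \<Rightarrow> bit \<Rightarrow> real"
  assumes "U 0 0 = 0" "U 1 1 = 0"
  shows "block_utility U n y x =
    (U 0 1 * card (zeros n y - zeros n x) + U 1 0 * card (zeros n x - zeros n y)) / n"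
proof -
  define A where "A = zeros n y - zeros n x"
  define B where "B = zeros n x - zeros n y"
  have "U (y i) (x i) = U 0 1 * of_bool (i \<in> A) + U 1 0 * of_bool (i \<in> B)"
    if "i < n" for i
    using assms that by (cases "x i"; cases "y i") (auto simp: zeros_def A_def B_def)
  then have "(\<Sum>i<n. U (y i) (x i)) = U 0 1 * (\<Sum>i<n. of_bool (i \<in> A)) + U 1 0 * (\<Sum>i<n. of_bool (i \<in> B))"
    by (simp only: sum.distrib[symmetric] sum_distrib_left) (intro sum.cong; simp)
  moreover have "(\<Sum>i<n. of_bool (i \<in> S)) = real (card S)" if "S \<subseteq> {..<n}" for S
    using that by (auto simp: of_bool_def sum.If_cases Int_absorb1)
  moreover have "A \<subseteq> {..<n}" "B \<subseteq> {..<n}"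
    by (auto simp: A_def B_def zeros_def)
  ultimately show ?thesis
    by (simp only: block_utility_def A_def B_def)
qed

section \<open>Concentration of the source and typical sequences\<close>

lemma set_pmf_source_subset: "set_pmf (source P n) \<subseteq> seqs n"
  unfolding source_def seqs_def
  by (auto simp: set_Pi_pmf PiE_dflt_def PiE_def extensional_def)

lemma pmf_source: "x \<in> seqs n \<Longrightarrow> pmf (source P n) x = (\<Prod>i<n. pmf P (x i))"
  unfolding source_def seqs_def by (subst pmf_Pi') (auto simp: PiE_def extensional_def)

lemma prob_source_seqs: "measure_pmf.prob (source P n) (seqs n) = 1"
  by (subst measure_pmf.prob_eq_1) (auto simp: AE_measure_pmf_iff intro: subsetD[OF set_pmf_source_subset])

text \<open>The summands may depend on the coordinate, since disagreement with a fixed sequence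
  does. The one-sided bound serves distances, the two-sided one typicality.\<close>

lemma source_hoeffding:
  fixes f :: "nat \<Rightarrow> 'a::finite \<Rightarrow> real" and P :: "'a pmf"
  assumes f: "\<And>i a. f i a \<in> {0..1}" and "0 \<le> \<epsilon>" "0 < n"
  defines "\<mu> \<equiv> \<Sum>i<n. measure_pmf.expectation P (f i)"
  shows "measure_pmf.prob (source P n) {x. (\<Sum>i<n. f i (x i)) \<le> \<mu> - \<epsilon>} \<le> exp (- 2 * \<epsilon>\<^sup>2 / n)"
    and "measure_pmf.prob (source P n) {x. \<bar>(\<Sum>i<n. f i (x i)) - \<mu>\<bar> \<ge> \<epsilon>} \<le> 2 * exp (- 2 * \<epsilon>\<^sup>2 / n)"
proof -
  have E: "measure_pmf.expectation (source P n) (\<lambda>x. f i (x i)) = measure_pmf.expectation P (f i)"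
    if "i < n" for i
  proof -
    have "P = map_pmf (\<lambda>x. x i) (source P n)"
      using that by (simp add: source_def Pi_pmf_component)
    then have "measure_pmf.expectation P (f i) = measure_pmf.expectation (map_pmf (\<lambda>x. x i) (source P n)) (f i)"
      by simp
    then show ?thesis
      by simp
  qed
  interpret Hoeffding_ineq "measure_pmf (source P n)" "{..<n}" "\<lambda>i x. f i (x i)" "\<lambda>_. 0" "\<lambda>_. 1" \<mu>
  proof unfold_locales
    have "prob_space.indep_vars (measure_pmf (source P n)) (\<lambda>_. count_space UNIV) (\<lambda>i x. x i) {..<n}"
      unfolding source_def by (rule indep_vars_Pi_pmf) simp
    then show "prob_space.indep_vars (measure_pmf (source P n)) (\<lambda>_. borel) (\<lambda>i x. f i (x i)) {..<n}"
      by (rule prob_space.indep_vars_compose2[OF measure_pmf.prob_space_axioms]) simp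
    show "\<mu> \<equiv> \<Sum>i<n. measure_pmf.expectation (source P n) (\<lambda>x. f i (x i))"
      unfolding \<mu>_def using E by (intro eq_reflection sum.cong) auto
  qed (use f in auto)
  show "measure_pmf.prob (source P n) {x. (\<Sum>i<n. f i (x i)) \<le> \<mu> - \<epsilon>} \<le> exp (- 2 * \<epsilon>\<^sup>2 / n)"
    using Hoeffding_ineq_le[of \<epsilon>] assms by simp
  show "measure_pmf.prob (source P n) {x. \<bar>(\<Sum>i<n. f i (x i)) - \<mu>\<bar> \<ge> \<epsilon>} \<le> 2 * exp (- 2 * \<epsilon>\<^sup>2 / n)"
    using Hoeffding_ineq_abs_ge[of \<epsilon>] assms by simp
qed

lemma expectation_bit: "measure_pmf.expectation P f = pmf P 0 * f 0 + pmf P 1 * f (1 :: bit)" for f :: "bit \<Rightarrow> real"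
  by (subst integral_measure_pmf_real[where A = UNIV]) (auto simp: sum_bit mult_ac)

text \<open>Each source symbol differs from the corresponding symbol of \<open>y\<close> with
  probability \<open>p\<close> or \<open>1 - p\<close>, hence at least \<open>p\<close>. The
  expected distance to any fixed \<open>y\<close> is thus at least \<open>p\<close>, and smaller
  distances are large deviations.\<close>

lemma prob_block_dist_le:
  fixes p :: real
  assumes P: "pmf P (0::bit) = p" "pmf P 1 = 1 - p" "p \<le> 1 / 2" and d: "d \<le> p" and n: "0 < n"
  shows "measure_pmf.prob (source P n) {x \<in> seqs n. block_dist n y x \<le> d} \<le> exp (- 2 * real n * (p - d)\<^sup>2)"
proof -
  define f where "f i b = (of_bool (y i \<noteq> b) :: real)" for i and b :: bit
  define \<mu> where "\<mu> = (\<Sum>i<n. measure_pmf.expectation P (f i))"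
  have "p \<le> measure_pmf.expectation P (f i)" for i
    using P by (cases "y i") (auto simp: expectation_bit f_def)
  then have \<mu>: "n * p \<le> \<mu>"
    using sum_mono[of "{..<n}" "\<lambda>_. p" "\<lambda>i. measure_pmf.expectation P (f i)"] by (simp add: \<mu>_def)
  have dist: "(\<Sum>i<n. f i (x i)) = n * block_dist n y x" for x
  proof -
    have "(\<Sum>i<n. f i (x i)) = (\<Sum>i\<in>{i\<in>{..<n}. y i \<noteq> x i}. 1)"
      unfolding f_def of_bool_def by (intro sum.mono_neutral_cong_right) auto
    then show ?thesis
      using n by (simp add: block_dist_def)
  qed
  have nd: "0 \<le> n * (p - d)"
    using d by simp
  have "measure_pmf.prob (source P n) {x \<in> seqs n. block_dist n y x \<le> d}
     \<le> measure_pmf.prob (source P n) {x. (\<Sum>i<n. f i (x i)) \<le> \<mu> - n * (p - d)}"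
  proof (intro measure_pmf.finite_measure_mono; clarsimp simp: dist)
    fix x
    assume "block_dist n y x \<le> d"
    then have "n * block_dist n y x \<le> n * d"
      by (intro mult_left_mono) auto
    then show "n * block_dist n y x \<le> \<mu> - n * (p - d)"
      using \<mu> by (simp add: algebra_simps)
  qed
  also have "\<dots> \<le> exp (- 2 * (n * (p - d))\<^sup>2 / n)"
    unfolding \<mu>_def by (rule source_hoeffding(1)) (use nd n in \<open>auto simp: f_def\<close>)
  also have "- 2 * (n * (p - d))\<^sup>2 / n = - 2 * real n * (p - d)\<^sup>2"
    using n by (simp add: power2_eq_square)
  finally show ?thesis .
qed

text \<open>The exponent 3/4 lies between 1/2 and 1: the Hoeffding exponent n^(3/2) / n still tends
  to infinity, while the relative deviation n^(-1/4) vanishes.\<close>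

definition typical :: "real \<Rightarrow> nat \<Rightarrow> (nat \<Rightarrow> bit) set" where
  "typical p n = {x \<in> seqs n. \<bar>real (card (zeros n x)) - n * p\<bar> < real n powr (3 / 4)}"

lemma prob_typical:
  fixes p :: real
  assumes P: "pmf P (0::bit) = p" and n: "0 < n"
  shows "measure_pmf.prob (source P n) (typical p n) \<ge> 1 - 2 * exp (- 2 * sqrt n)"
proof -
  define f where "f i b = (of_bool (b = 0) :: real)" for i :: nat and b :: bit
  define \<mu> where "\<mu> = (\<Sum>i<n. measure_pmf.expectation P (f i))"
  have \<mu>: "\<mu> = n * p"
    by (simp add: \<mu>_def expectation_bit f_def P)
  have dist: "(\<Sum>i<n. f i (x i)) = card (zeros n x)" for x
  proof -
    have "(\<Sum>i<n. f i (x i)) = (\<Sum>i\<in>zeros n x. 1)"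
      unfolding f_def of_bool_def by (intro sum.mono_neutral_cong_right) (auto simp: zeros_def)
    then show ?thesis
      by simp
  qed
  have "measure_pmf.prob (source P n) {x. \<bar>(\<Sum>i<n. f i (x i)) - \<mu>\<bar> \<ge> real n powr (3 / 4)}
     \<le> 2 * exp (- 2 * (real n powr (3 / 4))\<^sup>2 / n)"
    unfolding \<mu>_def by (rule source_hoeffding(2)) (use n in \<open>auto simp: f_def\<close>)
  also have "(real n powr (3 / 4))\<^sup>2 = n * sqrt n"
  proof -
    have "(real n powr (3 / 4))\<^sup>2 = real n powr (1 + 1 / 2)"
      using n by (simp add: powr_power)
    also have "\<dots> = n * sqrt n"
      using n by (subst powr_add) (simp add: powr_half_sqrt)
    finally show ?thesis .
  qed
  also have "- 2 * (n * sqrt n) / n = - 2 * sqrt n"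
    using n by simp
  finally have "measure_pmf.prob (source P n) {x. real n powr (3 / 4) \<le> \<bar>real (card (zeros n x)) - n * p\<bar>}
    \<le> 2 * exp (- 2 * sqrt n)"
    by (simp add: dist \<mu>)
  moreover have "measure_pmf.prob (source P n) (seqs n) \<le> measure_pmf.prob (source P n)
      (typical p n \<union> {x. real n powr (3 / 4) \<le> \<bar>real (card (zeros n x)) - n * p\<bar>})"
    by (intro measure_pmf.finite_measure_mono) (auto simp: typical_def)
  moreover have "\<dots> \<le> measure_pmf.prob (source P n) (typical p n) +
      measure_pmf.prob (source P n) {x. real n powr (3 / 4) \<le> \<bar>real (card (zeros n x)) - n * p\<bar>}"
    by (intro measure_Un_le) auto
  ultimately show ?thesis
    by (simp add: prob_source_seqs)
qed

section \<open>Probability and number of typical sequences, volume of Hamming balls\<close>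

lemma power_mult_power_eq_powr:
  fixes \<theta> :: real
  assumes "0 < \<theta>" "\<theta> < 1" "k \<le> n"
  shows "\<theta> ^ k * (1 - \<theta>) ^ (n - k) = 2 powr (k * log 2 \<theta> + (real n - real k) * log 2 (1 - \<theta>))"
proof -
  have "2 powr (real m * log 2 x) = x ^ m" if "0 < x" for m and x :: real
  proof -
    have "2 powr (real m * log 2 x) = (2 powr (log 2 x)) powr real m"
      by (simp only: powr_powr mult.commute)
    then show ?thesis
      using that by (simp add: powr_realpow)
  qed
  from this[of \<theta> k] this[of "1 - \<theta>" "n - k"] show ?thesis
    using assms by (simp add: powr_add of_nat_diff)
qed

lemma pmf_source_bit:
  fixes p :: real
  assumes P: "pmf P (0::bit) = p" "pmf P 1 = 1 - p" and p: "0 < p" "p < 1" and x: "x \<in> seqs n"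
  shows "pmf (source P n) x =
    2 powr (- real n * binary_entropy p - (card (zeros n x) - n * p) * log 2 ((1 - p) / p))"
proof -
  have "pmf (source P n) x = (\<Prod>i<n. if i \<in> zeros n x then p else (1 - p :: real))"
    unfolding pmf_source[OF x]
  proof (rule prod.cong)
    fix i
    assume "i \<in> {..<n}"
    then show "pmf P (x i) = (if i \<in> zeros n x then p else 1 - p)"
      by (cases "x i") (auto simp: P zeros_def)
  qed auto
  also have "\<dots> = p ^ card (zeros n x) * (1 - p) ^ (n - card (zeros n x))"
    using zeros_subset[of n x] by (simp add: prod.If_cases Int_absorb1 card_Diff_subset flip: Diff_eq)
  also have "\<dots> = 2 powr (card (zeros n x) * log 2 p + (n - real (card (zeros n x))) * log 2 (1 - p))"
    using p card_zeros_le[of n x] by (intro power_mult_power_eq_powr) auto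
  also have "card (zeros n x) * log 2 p + (n - real (card (zeros n x))) * log 2 (1 - p)
    = - real n * binary_entropy p - (card (zeros n x) - n * p) * log 2 ((1 - p) / p)"
    using p by (simp add: log_divide binary_entropy_def algebra_simps)
  finally show ?thesis .
qed

lemma typical_bounds:
  fixes p :: real
  assumes P: "pmf P (0::bit) = p" "pmf P 1 = 1 - p" and p: "0 < p" "p \<le> 1 / 2" and x: "x \<in> typical p n"
  defines "K \<equiv> log 2 ((1 - p) / p)"
  shows "pmf (source P n) x \<le> 2 powr (- real n * binary_entropy p + K * real n powr (3 / 4))"
    and "pmf (source P n) x \<ge> 2 powr (- real n * binary_entropy p - K * real n powr (3 / 4))"
proof -
  have K: "K \<ge> 0"
    using p by (simp add: K_def)
  have "\<bar>(card (zeros n x) - n * p) * K\<bar> \<le> real n powr (3 / 4) * K"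
    using x K unfolding abs_mult by (intro mult_mono) (auto simp: typical_def)
  then have "- (K * real n powr (3 / 4)) \<le> (card (zeros n x) - n * p) * K"
    "(card (zeros n x) - n * p) * K \<le> K * real n powr (3 / 4)"
    by (simp_all add: mult.commute abs_le_iff)
  moreover have "pmf (source P n) x = 2 powr (- real n * binary_entropy p - (card (zeros n x) - n * p) * K)"
    unfolding K_def by (rule pmf_source_bit) (use assms in \<open>auto simp: typical_def\<close>)
  ultimately show "pmf (source P n) x \<le> 2 powr (- real n * binary_entropy p + K * real n powr (3 / 4))"
    "pmf (source P n) x \<ge> 2 powr (- real n * binary_entropy p - K * real n powr (3 / 4))"
    by simp_all
qed

lemma card_typical_le:
  fixes p :: real
  assumes P: "pmf P (0::bit) = p" "pmf P 1 = 1 - p" and p: "0 < p" "p \<le> 1 / 2"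
  shows "real (card (typical p n)) \<le> 2 powr (n * binary_entropy p + log 2 ((1 - p) / p) * real n powr (3 / 4))"
proof -
  define e where "e = n * binary_entropy p + log 2 ((1 - p) / p) * real n powr (3 / 4)"
  have "real (card (typical p n)) * 2 powr (- e) \<le> (\<Sum>x\<in>typical p n. pmf (source P n) x)"
    using typical_bounds(2)[OF P p, of _ n] by (intro sum_bounded_below) (simp add: e_def)
  also have "\<dots> = measure_pmf.prob (source P n) (typical p n)"
    by (subst measure_measure_pmf_finite) (auto simp: typical_def)
  also have "\<dots> \<le> 1"
    by simp
  finally show ?thesis
    unfolding e_def[symmetric] by (simp add: powr_minus field_simps)
qed

text \<open>Exponential tilting: \<open>w\<close> is the law of \<open>y\<close> after a binary
  symmetric channel with crossover \<theta>. It has total mass 1, and since \<theta> is at most 1/2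
  it is smallest on the boundary of the ball. The radius need not be \<theta>, so that one \<theta>
  serves a whole sequence of radii.\<close>

lemma card_ball_le:
  fixes \<theta> d :: real
  assumes \<theta>: "0 < \<theta>" "\<theta> \<le> 1 / 2" and n: "0 < n"
  shows "real (card {x \<in> seqs n. block_dist n y (x :: nat \<Rightarrow> bit) \<le> d})
    \<le> 2 powr (n * (binary_entropy \<theta> + (d - \<theta>) * log 2 ((1 - \<theta>) / \<theta>)))"
proof -
  define K where "K = log 2 ((1 - \<theta>) / \<theta>)"
  define e where "e = n * (binary_entropy \<theta> + (d - \<theta>) * K)"
  have K: "K \<ge> 0"
    using \<theta> by (simp add: K_def)
  define w where "w x = (\<Prod>i<n. if y i \<noteq> x i then \<theta> else 1 - \<theta>)" for x :: "nat \<Rightarrow> bit"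
  have w: "w x = 2 powr (- real n * (binary_entropy \<theta> + (block_dist n y x - \<theta>) * K))" for x
  proof -
    define D where "D = card {k \<in> {..<n}. y k \<noteq> x k}"
    have D: "D \<le> n" "real n * block_dist n y x = D"
      using n card_mono[of "{..<n}" "{k \<in> {..<n}. y k \<noteq> x k}"] by (auto simp: D_def block_dist_def)
    have "{k \<in> {..<n}. \<not> y k \<noteq> x k} = {..<n} - {k \<in> {..<n}. y k \<noteq> x k}"
      by auto
    then have "card {k \<in> {..<n}. \<not> y k \<noteq> x k} = n - D"
      by (simp only: D_def) (subst card_Diff_subset, auto)
    then have "w x = \<theta> ^ D * (1 - \<theta>) ^ (n - D)"
      unfolding w_def by (subst prod.If_cases) (auto simp: Int_def D_def)
    also have "\<dots> = 2 powr (D * log 2 \<theta> + (n - real D) * log 2 (1 - \<theta>))"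
      using \<theta> D by (intro power_mult_power_eq_powr) auto
    also have "D * log 2 \<theta> + (n - real D) * log 2 (1 - \<theta>)
      = - real n * (binary_entropy \<theta> - \<theta> * K) - D * K"
      using \<theta> by (simp add: K_def log_divide binary_entropy_def algebra_simps)
    also have "\<dots> = - real n * (binary_entropy \<theta> + (block_dist n y x - \<theta>) * K)"
      unfolding D(2)[symmetric] by (simp add: algebra_simps)
    finally show ?thesis .
  qed
  define B where "B = {x \<in> seqs n. block_dist n y x \<le> d}"
  have "real (card B) * 2 powr (- e) \<le> (\<Sum>x\<in>B. w x)"
  proof (rule sum_bounded_below)
    fix x
    assume "x \<in> B"
    then have "(block_dist n y x - \<theta>) * K \<le> (d - \<theta>) * K"
      using K by (intro mult_right_mono) (auto simp: B_def)
    then have "n * (binary_entropy \<theta> + (block_dist n y x - \<theta>) * K) \<le> e"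
      unfolding e_def by (intro mult_left_mono) auto
    then show "2 powr (- e) \<le> w x"
      by (simp add: w)
  qed
  also have "\<dots> \<le> (\<Sum>x\<in>seqs n. w x)"
    by (intro sum_mono2) (auto simp: B_def w)
  also have "\<dots> = (\<Prod>i<n. \<Sum>b\<in>UNIV. if y i \<noteq> b then \<theta> else 1 - \<theta>)"
    unfolding w_def seqs_def by (subst prod_sum_PiE) auto
  also have "\<dots> = 1"
    by (auto simp: sum_bit intro!: prod.neutral)
  finally show ?thesis
    unfolding B_def[symmetric] K_def[symmetric] e_def[symmetric] by (simp add: powr_minus field_simps)
qed

section \<open>Volume bound on the number of recovered sequences\<close>

lemma strategies_in_seqs: "s \<in> strategies n \<Longrightarrow> x \<in> seqs n \<Longrightarrow> s x \<in> seqs n"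
  by (auto simp: strategies_def)

lemma finite_decoded_set [simp]: "finite (decoded_set d n g s)"
  by (simp add: decoded_set_def)

lemma finite_recovered_set [simp]: "finite (recovered_set d n g s)"
  by (simp add: recovered_set_def)

lemma decoded_subset_balls:
  assumes "s \<in> strategies n"
  shows "decoded_set d n g s \<subseteq> (\<Union>y\<in>recovered_set d n g s. {x \<in> seqs n. block_dist n y x \<le> d})"
  using strategies_in_seqs[OF assms] by (fastforce simp: decoded_set_def recovered_set_def)

text \<open>The decoded sequences lie in the balls around the recovered ones. Intersecting with the
  typical set turns this covering by cardinality into one by probability, because typical sequences
  are nearly equiprobable.\<close>

lemma card_recovered_set_ge:
  fixes P :: "bit pmf"
  assumes P: "pmf P 0 = p" "pmf P 1 = 1 - p" and p: "0 < p" "p \<le> 1 / 2"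
    and \<theta>: "0 < \<theta>" "\<theta> \<le> 1 / 2" and n: "0 < n" and s: "s \<in> strategies n"
  shows "1 - error_prob P d n g s - 2 * exp (- 2 * sqrt n) \<le> card (recovered_set d n g s) *
    2 powr (n * (binary_entropy \<theta> - binary_entropy p + (d - \<theta>) * log 2 ((1 - \<theta>) / \<theta>))
      + log 2 ((1 - p) / p) * real n powr (3 / 4))"
proof -
  define T where "T = decoded_set d n g s \<inter> typical p n"
  define b where "b = 2 powr (n * (binary_entropy \<theta> + (d - \<theta>) * log 2 ((1 - \<theta>) / \<theta>)))"
  define c where "c = 2 powr (- real n * binary_entropy p + log 2 ((1 - p) / p) * real n powr (3 / 4))"
  have "measure_pmf.prob (source P n) (decoded_set d n g s)
    \<le> measure_pmf.prob (source P n) (T \<union> (seqs n - typical p n))"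
    by (intro measure_pmf.finite_measure_mono) (auto simp: T_def decoded_set_def)
  also have "\<dots> \<le> measure_pmf.prob (source P n) T + measure_pmf.prob (source P n) (seqs n - typical p n)"
    by (intro measure_Un_le) auto
  also have "measure_pmf.prob (source P n) (seqs n - typical p n) = 1 - measure_pmf.prob (source P n) (typical p n)"
    by (subst measure_pmf.finite_measure_Diff) (auto simp: typical_def prob_source_seqs)
  finally have "1 - error_prob P d n g s - 2 * exp (- 2 * sqrt n) \<le> measure_pmf.prob (source P n) T"
    using prob_typical[OF P(1) n] by (simp add: error_prob_def)
  also have "\<dots> = (\<Sum>x\<in>T. pmf (source P n) x)"
    by (subst measure_measure_pmf_finite) (auto simp: T_def)
  also have "\<dots> \<le> real (card T) * c"
    unfolding c_def T_def by (intro sum_bounded_above typical_bounds(1) P p) auto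
  also have "real (card T) \<le> real (card (recovered_set d n g s)) * b"
  proof -
    have "card T \<le> card (\<Union>y\<in>recovered_set d n g s. {x \<in> seqs n. block_dist n y x \<le> d})"
      using decoded_subset_balls[OF s, of d g] by (intro card_mono) (auto simp: T_def)
    also have "\<dots> \<le> (\<Sum>y\<in>recovered_set d n g s. card {x \<in> seqs n. block_dist n y x \<le> d})"
      by (rule card_UN_le) simp
    finally have "real (card T) \<le> (\<Sum>y\<in>recovered_set d n g s. real (card {x \<in> seqs n. block_dist n y x \<le> d}))"
      by (simp flip: of_nat_sum)
    also have "\<dots> \<le> real (card (recovered_set d n g s)) * b"
      unfolding b_def by (intro sum_bounded_above card_ball_le \<theta> n)
    finally show ?thesis .
  qed
  then have "real (card T) * c \<le> real (card (recovered_set d n g s)) * b * c"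
    by (intro mult_right_mono) (auto simp: c_def)
  also have "\<dots> = card (recovered_set d n g s) *
    2 powr (n * (binary_entropy \<theta> - binary_entropy p + (d - \<theta>) * log 2 ((1 - \<theta>) / \<theta>))
      + log 2 ((1 - p) / p) * real n powr (3 / 4))"
    by (simp add: b_def c_def algebra_simps flip: powr_add)
  finally show ?thesis by simp
qed

lemma block_rate_ge:
  fixes P :: "bit pmf"
  assumes P: "pmf P 0 = p" "pmf P 1 = 1 - p" and p: "0 < p" "p \<le> 1 / 2"
    and \<theta>: "0 < \<theta>" "\<theta> \<le> 1 / 2" and n: "0 < n" and s: "s \<in> strategies n"
    and err: "error_prob P d n g s + 2 * exp (- 2 * sqrt n) \<le> 1 / 2"
  shows "block_rate d n g s \<ge> binary_entropy p - binary_entropy \<theta> - (d - \<theta>) * log 2 ((1 - \<theta>) / \<theta>)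
      - log 2 ((1 - p) / p) * real n powr (- 1 / 4) - 1 / n"
proof -
  define e where "e = n * (binary_entropy \<theta> - binary_entropy p + (d - \<theta>) * log 2 ((1 - \<theta>) / \<theta>))
      + log 2 ((1 - p) / p) * real n powr (3 / 4)"
  define c where "c = real (card (recovered_set d n g s))"
  have ce: "1 / 2 \<le> c * 2 powr e"
    using card_recovered_set_ge[OF P p \<theta> n s, of d g] err by (simp add: e_def c_def)
  then have "c > 0"
    by (cases "c = 0") (auto simp: c_def)
  \<comment> \<open>The decoded typical set has probability at least 1/2. Its logarithm -1 is the
    origin of the term 1 / n.\<close>
  have "log 2 (1 / 2) \<le> log 2 (c * 2 powr e)"
    using ce by (intro log_mono) auto
  also have "\<dots> = log 2 c + e"
    using \<open>c > 0\<close> by (simp add: log_mult)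
  finally have "(- 1 - e) / n \<le> log 2 c / n"
    using n by (intro divide_right_mono) (auto simp: log_divide)
  moreover have "real n powr (3 / 4) / n = real n powr (- 1 / 4)"
    using n powr_diff[of "real n" "3 / 4" 1] by simp
  ultimately show ?thesis
    using n by (simp add: block_rate_def c_def e_def field_simps)
qed

section \<open>Best responses\<close>

text \<open>A constant strategy sends any desired message, so each type can obtain every element of
  the image. Optimality thus becomes a pointwise comparison over the image of
  \<open>g\<close>.\<close>

lemma best_responses_iff:
  assumes "g \<in> strategies n"
  shows "s \<in> best_responses U n g \<longleftrightarrow> s \<in> strategies n \<and>
    (\<forall>x\<in>seqs n. \<forall>y\<in>g ` seqs n. block_utility U n y x \<le> block_utility U n (g (s x)) x)"
proof -
  have ex: "\<exists>s'\<in>strategies n. s' x = m" if "x \<in> seqs n" "m \<in> seqs n" for x m :: "nat \<Rightarrow> 'a"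
    using that by (intro bexI[of _ "\<lambda>_\<in>seqs n. m"]) (auto simp: strategies_def)
  have "(\<forall>s'\<in>strategies n. block_utility U n (g (s' x)) x \<le> c) \<longleftrightarrow>
      (\<forall>y\<in>g ` seqs n. block_utility U n y x \<le> c)" if x: "x \<in> seqs n" for x c
  proof
    assume L: "\<forall>s'\<in>strategies n. block_utility U n (g (s' x)) x \<le> c"
    show "\<forall>y\<in>g ` seqs n. block_utility U n y x \<le> c"
    proof clarify
      fix m :: "nat \<Rightarrow> 'a"
      assume "m \<in> seqs n"
      then obtain s' where "s' \<in> strategies n" "s' x = m"
        using ex[OF x] by blast
      then show "block_utility U n (g m) x \<le> c"
        using L by auto
    qed
  qed (use strategies_in_seqs[OF _ x] in blast)
  then show ?thesis
    by (simp add: best_responses_def)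
qed

lemma best_responses_ne:
  fixes g :: "'a::finite strategy"
  assumes g: "g \<in> strategies n"
  shows "best_responses U n g \<noteq> {}"
proof -
  have "\<exists>m\<in>seqs n. \<forall>m'\<in>seqs n. block_utility U n (g m') x \<le> block_utility U n (g m) x" for x
  proof -
    define V where "V = (\<lambda>m. block_utility U n (g m) x) ` seqs n"
    have "(\<lambda>_\<in>{..<n}. undefined) \<in> (seqs n :: (nat \<Rightarrow> 'a) set)"
      by (auto simp: seqs_def)
    then have V: "finite V" "V \<noteq> {}"
      by (auto simp: V_def)
    from Max_in[OF V] obtain m where m: "m \<in> seqs n" "block_utility U n (g m) x = Max V"
      by (auto simp: V_def)
    then show ?thesis
      using V by (intro bexI[of _ m]) (auto simp: V_def)
  qed
  then obtain f where f: "\<And>x. f x \<in> seqs n"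
    "\<And>x m'. m' \<in> seqs n \<Longrightarrow> block_utility U n (g m') x \<le> block_utility U n (g (f x)) x"
    by metis
  have "restrict f (seqs n) \<in> best_responses U n g"
    unfolding best_responses_iff[OF g] using f by (auto simp: strategies_def)
  then show ?thesis
    by auto
qed

lemma worst_responses_iff:
  "s \<in> worst_responses P U d n g \<longleftrightarrow> s \<in> best_responses U n g \<and>
    (\<forall>t\<in>best_responses U n g. error_prob P d n g t \<le> error_prob P d n g s)"
  by (auto simp: worst_responses_def is_arg_max_linorder)

text \<open>The maximum is attained because extensional strategies form a finite set.\<close>

lemma worst_responses_ne:
  fixes g :: "'a::finite strategy"
  assumes g: "g \<in> strategies n"
  shows "worst_responses P U d n g \<noteq> {}"
proof -
  have "finite (strategies n :: 'a strategy set)"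
    unfolding strategies_def by (intro finite_PiE) auto
  then have "finite (best_responses U n g)"
    by (rule rev_finite_subset) (auto simp: best_responses_def)
  then have V: "finite (error_prob P d n g ` best_responses U n g)" "error_prob P d n g ` best_responses U n g \<noteq> {}"
    using best_responses_ne[OF g] by auto
  from Max_in[OF V] obtain s where "s \<in> best_responses U n g"
    "error_prob P d n g s = Max (error_prob P d n g ` best_responses U n g)"
    by auto
  then have "s \<in> worst_responses P U d n g"
    using V by (auto simp: worst_responses_iff)
  then show ?thesis
    by auto
qed

text \<open>Designing a receiver reduces to choosing a set of sequences: keep its elements fixed and
  map everything else to one of them.\<close>

lemma strategy_with_image:
  assumes "I \<subseteq> seqs n" "I \<noteq> {}"
  obtains g where "g \<in> strategies n" "g ` seqs n = I"
proof -
  obtain y where "y \<in> I"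
    using assms by auto
  define g where "g = (\<lambda>x\<in>seqs n. if x \<in> I then x else y)"
  have "g ` seqs n = I"
    using assms \<open>y \<in> I\<close> by (auto simp: g_def image_iff)
  moreover have "g \<in> strategies n"
    using assms \<open>y \<in> I\<close> by (auto simp: strategies_def g_def split: if_splits)
  ultimately show thesis
    using that by blast
qed

lemma error_prob_le:
  fixes P :: "bit pmf"
  assumes "pmf P 0 = p" "0 < n" "typical p n \<subseteq> decoded_set d n g s"
  shows "error_prob P d n g s \<le> 2 * exp (- 2 * sqrt n)"
  using prob_typical[OF assms(1,2)] measure_pmf.finite_measure_mono[OF assms(3), of "source P n"]
  by (simp add: error_prob_def)

text \<open>Decoding and rate are required for every best response to a receiver with the given
  image. They hold in particular for a worst one, whichever it is.\<close>

lemma achievable_by_images: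
  fixes P :: "bit pmf" and U :: "bit \<Rightarrow> bit \<Rightarrow> real" and l u \<delta> :: "nat \<Rightarrow> real"
  assumes P: "pmf P 0 = p"
    and \<delta>: "\<And>n. 0 < n \<Longrightarrow> 0 < \<delta> n" "\<delta> \<longlonglongrightarrow> 0"
    and I: "\<And>n. 0 < n \<Longrightarrow> I n \<subseteq> seqs n" "\<And>n. 0 < n \<Longrightarrow> I n \<noteq> {}"
    and dec: "\<And>n g s. 0 < n \<Longrightarrow> g \<in> strategies n \<Longrightarrow> g ` seqs n = I n \<Longrightarrow> s \<in> best_responses U n g \<Longrightarrow>
      typical p n \<subseteq> decoded_set (d + \<delta> n) n g s"
    and rate: "\<forall>\<^sub>F n in sequentially. \<forall>g s. g \<in> strategies n \<longrightarrow> g ` seqs n = I n \<longrightarrow> s \<in> best_responses U n g \<longrightarrow>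
      l n \<le> block_rate (d + \<delta> n) n g s \<and> block_rate (d + \<delta> n) n g s \<le> u n"
    and lim: "l \<longlonglongrightarrow> R" "u \<longlonglongrightarrow> R"
  shows "achievable P U d R"
proof -
  have "\<exists>g s. g \<in> strategies n \<and> g ` seqs n = I n \<and> s \<in> worst_responses P U (d + \<delta> n) n g" if n: "0 < n" for n
  proof -
    obtain g where "g \<in> strategies n" "g ` seqs n = I n"
      using strategy_with_image[of "I n" n] I(1,2)[OF n] by auto
    then show ?thesis
      using worst_responses_ne[of g n P U "d + \<delta> n"] by auto
  qed
  then obtain g s where gs: "\<And>n. 0 < n \<Longrightarrow> g n \<in> strategies n" "\<And>n. 0 < n \<Longrightarrow> g n ` seqs n = I n"
    "\<And>n. 0 < n \<Longrightarrow> s n \<in> worst_responses P U (d + \<delta> n) n (g n)"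
    by metis
  have best: "s n \<in> best_responses U n (g n)" if "0 < n" for n
    using gs(3)[OF that] by (simp add: worst_responses_iff)
  \<comment> \<open>The factor 3, where the typical set gives 2, makes the error bound
    strict.\<close>
  define \<epsilon> where "\<epsilon> n = 3 * exp (- 2 * sqrt (real n))" for n
  have "error_prob P (d + \<delta> n) n (g n) (s n) < \<epsilon> n" if "0 < n" for n
    using error_prob_le[OF P that dec[OF that gs(1,2)[OF that] best[OF that]]]
    unfolding \<epsilon>_def by (rule le_less_trans) simp
  moreover have "\<epsilon> \<longlonglongrightarrow> 0"
    unfolding \<epsilon>_def by real_asymp
  moreover have "(\<lambda>n. block_rate (d + \<delta> n) n (g n) (s n)) \<longlonglongrightarrow> R"
  proof (rule real_tendsto_sandwich[OF _ _ lim])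
    have ev: "\<forall>\<^sub>F n in sequentially. l n \<le> block_rate (d + \<delta> n) n (g n) (s n) \<and>
        block_rate (d + \<delta> n) n (g n) (s n) \<le> u n"
      using rate eventually_gt_at_top[of 0] by eventually_elim (use gs best in blast)
    then show "\<forall>\<^sub>F n in sequentially. l n \<le> block_rate (d + \<delta> n) n (g n) (s n)"
      by (rule eventually_mono) auto
    from ev show "\<forall>\<^sub>F n in sequentially. block_rate (d + \<delta> n) n (g n) (s n) \<le> u n"
      by (rule eventually_mono) auto
  qed
  ultimately show ?thesis
    unfolding achievable_def using gs \<delta>
    by (intro exI[of _ g] exI[of _ s] exI[of _ \<epsilon>] exI[of _ \<delta>]) (auto simp: \<epsilon>_def)
qed

text \<open>Up to a multiple of the Hamming distance, the utility of a recovered sequence depends only on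
  the numbers of zeros, because the excess of one kind of mistake over the other is the difference of
  these numbers.\<close>

lemma block_utility_eq_dist:
  fixes U :: "bit \<Rightarrow> bit \<Rightarrow> real"
  assumes "U 0 0 = 0" "U 1 1 = 0"
  shows "block_utility U n y x = (U 0 1 + U 1 0) / 2 * block_dist n y x +
    (U 0 1 - U 1 0) / 2 * ((real (card (zeros n y)) - real (card (zeros n x))) / n)"
proof -
  have "card (zeros n y) + card (zeros n x - zeros n y) = card (zeros n x) + card (zeros n y - zeros n x)"
    by (rule card_eq_offset) auto
  then have *: "real (card (zeros n y)) - real (card (zeros n x)) =
      real (card (zeros n y - zeros n x)) - real (card (zeros n x - zeros n y))"
    by linarith
  show ?thesis
    unfolding * block_utility_zeros[of U, OF assms] block_dist_zeros
    by (cases "n = 0") (simp_all add: field_simps)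
qed

section \<open>Reports to codes in one layer and truthful reports\<close>

lemma block_dist_self [simp]: "block_dist n x x = 0"
  by (simp add: block_dist_def)

lemma block_dist_nonneg: "0 \<le> block_dist n y x"
  by (simp add: block_dist_def)

lemma block_dist_triangle: "block_dist n x z \<le> block_dist n x y + block_dist n y z"
proof -
  have "card {k \<in> {..<n}. x k \<noteq> z k} \<le> card ({k \<in> {..<n}. x k \<noteq> y k} \<union> {k \<in> {..<n}. y k \<noteq> z k})"
    by (intro card_mono) auto
  also have "\<dots> \<le> card {k \<in> {..<n}. x k \<noteq> y k} + card {k \<in> {..<n}. y k \<noteq> z k}"
    by (rule card_Un_le)
  finally have "real (card {k \<in> {..<n}. x k \<noteq> z k}) \<le>
      real (card {k \<in> {..<n}. x k \<noteq> y k}) + real (card {k \<in> {..<n}. y k \<noteq> z k})"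
    by linarith
  then show ?thesis
    unfolding block_dist_def add_divide_distrib[symmetric] by (rule divide_right_mono) simp
qed

lemma block_dist_eq_0D:
  assumes "block_dist n y x = 0" "0 < n" "x \<in> seqs n" "y \<in> seqs n"
  shows "y = x"
  using assms by (intro seqs_eqI[of y n x]) (auto simp: block_dist_def)

lemma best_response_nearest:
  fixes U :: "bit \<Rightarrow> bit \<Rightarrow> real"
  assumes U: "U 0 0 = 0" "U 1 1 = 0" "U 0 1 + U 1 0 < 0"
    and g: "g \<in> strategies n" and s: "s \<in> best_responses U n g"
    and layer: "\<And>y. y \<in> g ` seqs n \<Longrightarrow> card (zeros n y) = m"
    and xy: "x \<in> seqs n" "y \<in> g ` seqs n"
  shows "block_dist n (g (s x)) x \<le> block_dist n y x"
proof -
  have sx: "s x \<in> seqs n"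
    using s xy(1) g by (auto simp: best_responses_iff intro: strategies_in_seqs)
  have "block_utility U n y x \<le> block_utility U n (g (s x)) x"
    using s xy g by (auto simp: best_responses_iff)
  then have "(U 0 1 + U 1 0) / 2 * block_dist n y x \<le> (U 0 1 + U 1 0) / 2 * block_dist n (g (s x)) x"
    unfolding block_utility_eq_dist[of U, OF U(1,2)] using layer[OF xy(2)] layer[of "g (s x)"] sx by simp
  then show ?thesis
    using U(3) by (simp add: mult_le_cancel_left)
qed

text \<open>Truth has utility 0 and each kind of mistake has a strictly negative cost, so neither
  kind can occur. No condition on the numbers of zeros in the image enters.\<close>

lemma best_response_exact:
  fixes U :: "bit \<Rightarrow> bit \<Rightarrow> real"
  assumes U: "U 0 0 = 0" "U 1 1 = 0" "U 0 1 < 0" "U 1 0 < 0" and n: "0 < n"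
    and g: "g \<in> strategies n" and s: "s \<in> best_responses U n g"
    and x: "x \<in> seqs n" "x \<in> g ` seqs n"
  shows "g (s x) = x"
proof -
  have "s x \<in> seqs n"
    using s x(1) g by (auto simp: best_responses_iff intro: strategies_in_seqs)
  then have y: "g (s x) \<in> seqs n"
    using g by (rule strategies_in_seqs[rotated])
  define u where "u = real (card (zeros n (g (s x)) - zeros n x))"
  define v where "v = real (card (zeros n x - zeros n (g (s x))))"
  have "block_utility U n x x \<le> block_utility U n (g (s x)) x"
    using s x g by (auto simp: best_responses_iff)
  then have "0 \<le> U 0 1 * u + U 1 0 * v"
    using n by (simp add: block_utility_zeros[of U, OF U(1,2)] u_def v_def zero_le_divide_iff)
  moreover have "U 0 1 * u \<le> 0" "U 1 0 * v \<le> 0"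
    using U by (simp_all add: u_def v_def mult_nonpos_nonneg)
  ultimately have "U 0 1 * u = 0" "U 1 0 * v = 0"
    by linarith+
  then have "u = 0" "v = 0"
    using U by auto
  then have "zeros n (g (s x)) = zeros n x"
    by (auto simp: u_def v_def)
  then show ?thesis
    using y x(1) by (intro zeros_inj)
qed

text \<open>The value 0 of the logarithm at 0 makes this cover empty sets as well, which is why
  \<open>x\<close> has to be at least 1.\<close>

lemma log_card_le:
  assumes "real a \<le> x" "1 \<le> x"
  shows "log 2 (real a) \<le> log 2 x"
  using assms by (cases "a = 0") (simp_all add: log_def divide_right_mono)

text \<open>This carries a lower bound at the level \<theta> of a code over to the permitted level
  \<open>d\<close>.\<close>

lemma block_rate_mono:
  assumes "d \<le> d'"
  shows "block_rate d n g s \<le> block_rate d' n g s"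
proof -
  have "recovered_set d n g s \<subseteq> recovered_set d' n g s"
    using assms by (auto simp: recovered_set_def decoded_set_def)
  then have "card (recovered_set d n g s) \<le> card (recovered_set d' n g s)"
    by (intro card_mono) auto
  then have "log 2 (card (recovered_set d n g s)) \<le> log 2 (card (recovered_set d' n g s))"
    by (cases "recovered_set d' n g s = {}") (auto intro!: log_card_le simp: Suc_le_eq card_gt_0_iff)
  then show ?thesis
    unfolding block_rate_def by (rule divide_right_mono) simp
qed

lemma block_rate_nonneg: "0 \<le> block_rate d n g s"
  unfolding block_rate_def
  by (cases "card (recovered_set d n g s)") (auto simp: log_def)

lemma block_rate_le_image:
  assumes "real (card (g ` seqs n)) \<le> x" "1 \<le> x"
  shows "block_rate d n g s \<le> log 2 x / n"
proof -
  have "card (recovered_set d n g s) \<le> card (g ` seqs n)"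
    by (intro card_mono) (auto simp: recovered_set_def)
  then show ?thesis
    using assms unfolding block_rate_def by (intro divide_right_mono log_card_le) auto
qed

lemma block_rate_le_1:
  fixes g :: "bit strategy"
  assumes "0 < n"
  shows "block_rate d n g s \<le> 1"
proof -
  have "card (g ` seqs n) \<le> 2 ^ n"
    using card_image_le[of "seqs n" g] by (simp add: card_seqs)
  then have "real (card (g ` seqs n)) \<le> 2 ^ n"
    by (metis of_nat_le_iff of_nat_numeral of_nat_power)
  then show ?thesis
    using block_rate_le_image[of g n "2 ^ n" d s] assms by (simp add: log_nat_power)
qed

section \<open>Bounds on all achievable rates\<close>

lemma achievable_rate_bounds:
  fixes P :: "bit pmf"
  assumes "achievable P U d R"
  shows "0 \<le> R" "R \<le> 1"
proof -
  from assms obtain g s :: "nat \<Rightarrow> bit strategy" and \<delta> where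
    lim: "(\<lambda>n. block_rate (d + \<delta> n) n (g n) (s n)) \<longlonglongrightarrow> R"
    unfolding achievable_def by blast
  from lim show "0 \<le> R"
    by (rule LIMSEQ_le_const) (auto simp: block_rate_nonneg)
  from lim show "R \<le> 1"
    by (rule LIMSEQ_le_const2) (auto intro!: exI[of _ 1] block_rate_le_1)
qed

text \<open>The volume bound is used with \<theta> = \<open>d\<close> for every \<open>n\<close>.
  The actual level \<open>d + \<delta> n\<close> then enters only through \<open>\<delta> n\<close>
  times a constant slope, and the bound survives the limit.\<close>

lemma achievable_rate_ge:
  fixes P :: "bit pmf"
  assumes P: "pmf P 0 = p" "pmf P 1 = 1 - p" and p: "0 < p" "p \<le> 1 / 2" and d: "0 < d" "d \<le> 1 / 2"
    and ach: "achievable P U d R"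
  shows "binary_entropy p - binary_entropy d \<le> R"
proof -
  from ach obtain g s \<epsilon> \<delta> where s: "\<And>n. n \<ge> 1 \<Longrightarrow> s n \<in> worst_responses P U (d + \<delta> n) n (g n)"
    and err: "\<And>n. n \<ge> 1 \<Longrightarrow> error_prob P (d + \<delta> n) n (g n) (s n) < \<epsilon> n"
    and lim: "\<epsilon> \<longlonglongrightarrow> 0" "\<delta> \<longlonglongrightarrow> 0" "(\<lambda>n. block_rate (d + \<delta> n) n (g n) (s n)) \<longlonglongrightarrow> R"
    unfolding achievable_def by blast
  define low where "low n = binary_entropy p - binary_entropy d - \<delta> n * log 2 ((1 - d) / d)
    - log 2 ((1 - p) / p) * real n powr (- 1 / 4) - 1 / n" for n
  have "(\<lambda>n. real n powr (- 1 / 4)) \<longlonglongrightarrow> 0" "(\<lambda>n. 1 / real n) \<longlonglongrightarrow> 0"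
    by real_asymp+
  then have "low \<longlonglongrightarrow> binary_entropy p - binary_entropy d - 0 * log 2 ((1 - d) / d) - log 2 ((1 - p) / p) * 0 - 0"
    unfolding low_def by (intro tendsto_intros lim)
  then have low: "low \<longlonglongrightarrow> binary_entropy p - binary_entropy d"
    by simp
  have "(\<lambda>n. exp (- 2 * sqrt (real n))) \<longlonglongrightarrow> 0"
    by real_asymp
  then have "(\<lambda>n. \<epsilon> n + 2 * exp (- 2 * sqrt (real n))) \<longlonglongrightarrow> 0 + 2 * 0"
    by (intro tendsto_intros lim)
  then have "\<forall>\<^sub>F n in sequentially. \<epsilon> n + 2 * exp (- 2 * sqrt (real n)) < 1 / 2"
    by (rule order_tendstoD) simp
  then have "\<forall>\<^sub>F n in sequentially. low n \<le> block_rate (d + \<delta> n) n (g n) (s n)"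
    using eventually_ge_at_top[of 1]
  proof eventually_elim
    case (elim n)
    have "block_rate (d + \<delta> n) n (g n) (s n) \<ge> binary_entropy p - binary_entropy d
      - (d + \<delta> n - d) * log 2 ((1 - d) / d) - log 2 ((1 - p) / p) * real n powr (- 1 / 4) - 1 / n"
    proof (rule block_rate_ge[OF P p d])
      show "s n \<in> strategies n"
        using s[of n] elim by (auto simp: worst_responses_iff best_responses_def)
      show "error_prob P (d + \<delta> n) n (g n) (s n) + 2 * exp (- 2 * sqrt (real n)) \<le> 1 / 2"
        using err[of n] elim by linarith
    qed (use elim in auto)
    then show ?case
      by (simp add: low_def)
  qed
  then show ?thesis
    using low lim(3) by (intro tendsto_le[of sequentially]) auto
qed

text \<open>If \<open>x\<close> and \<open>x'\<close> are recovered as \<open>y\<close> and \<open>y'\<close>, then neither sender type gains by imitating the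
  other. Adding the two inequalities cancels the numbers of zeros, so that for a positive coefficient
  the distances \<open>d(y', x)\<close> and \<open>d(y, x')\<close> cannot both exceed the distortion level. For independent
  \<open>x\<close> and \<open>x'\<close> both are, however, about \<open>p\<close> or more.\<close>

lemma prob_decoded_le_pos:
  fixes U :: "bit \<Rightarrow> bit \<Rightarrow> real" and P :: "bit pmf"
  assumes P: "pmf P 0 = p" "pmf P 1 = 1 - p" "p \<le> 1 / 2" and d: "d \<le> p" and n: "0 < n"
    and U: "U 0 0 = 0" "U 1 1 = 0" "U 0 1 + U 1 0 > 0"
    and g: "g \<in> strategies n" and s: "s \<in> best_responses U n g"
  shows "measure_pmf.prob (source P n) (decoded_set d n g s) \<le> 2 * exp (- 2 * real n * (p - d)\<^sup>2)"
proof -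
  define D where "D = decoded_set d n g s"
  define w where "w = pmf (source P n)"
  define B where "B x = {x' \<in> seqs n. block_dist n (g (s x)) x' \<le> d}" for x
  have fin: "finite D"
    by (simp add: D_def)
  have prob: "measure_pmf.prob (source P n) S = (\<Sum>x\<in>S. w x)" if "finite S" for S
    using that by (simp add: w_def measure_measure_pmf_finite)
  have w: "w x \<ge> 0" for x
    by (simp add: w_def)
  have cross: "x' \<in> B x \<or> x \<in> B x'" if "x \<in> D" "x' \<in> D" for x x'
  proof (rule ccontr)
    assume "\<not> ?thesis"
    moreover have x: "x \<in> seqs n" "x' \<in> seqs n" "block_dist n (g (s x)) x \<le> d" "block_dist n (g (s x')) x' \<le> d"
      using that by (auto simp: D_def decoded_set_def)
    ultimately have far: "block_dist n (g (s x)) x' > d" "block_dist n (g (s x')) x > d"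
      by (auto simp: B_def)
    have "g (s x) \<in> g ` seqs n" "g (s x') \<in> g ` seqs n"
      using s x g by (auto simp: best_responses_iff intro: strategies_in_seqs)
    then have "block_utility U n (g (s x')) x \<le> block_utility U n (g (s x)) x"
      "block_utility U n (g (s x)) x' \<le> block_utility U n (g (s x')) x'"
      using s x g by (auto simp: best_responses_iff)
    then have "block_utility U n (g (s x')) x + block_utility U n (g (s x)) x'
        \<le> block_utility U n (g (s x)) x + block_utility U n (g (s x')) x'"
      by (rule add_mono)
    then have "(U 0 1 + U 1 0) / 2 * (block_dist n (g (s x')) x + block_dist n (g (s x)) x')
      \<le> (U 0 1 + U 1 0) / 2 * (block_dist n (g (s x)) x + block_dist n (g (s x')) x')"
      unfolding block_utility_eq_dist[of U, OF U(1,2)] by (simp add: algebra_simps diff_divide_distrib)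
    then show False
      using U(3) far x by (simp add: mult_le_cancel_left)
  qed
  \<comment> \<open>The squared probability of \<open>D\<close> is a sum over pairs. By
    \<open>cross\<close> each pair is charged to one of two ball events, which contribute equally by
    symmetry, and one factor of the probability then cancels.\<close>
  have "(\<Sum>x\<in>D. w x) * (\<Sum>x'\<in>D. w x') = (\<Sum>x\<in>D. \<Sum>x'\<in>D. w x * w x')"
    by (rule sum_product)
  also have "\<dots> \<le> (\<Sum>x\<in>D. \<Sum>x'\<in>D. w x * w x' * of_bool (x' \<in> B x) + w x' * w x * of_bool (x \<in> B x'))"
    using cross w by (intro sum_mono) (auto simp: of_bool_def)
  also have "\<dots> = (\<Sum>x\<in>D. \<Sum>x'\<in>D. w x * w x' * of_bool (x' \<in> B x)) + (\<Sum>x\<in>D. \<Sum>x'\<in>D. w x' * w x * of_bool (x \<in> B x'))"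
    by (simp add: sum.distrib)
  also have "(\<Sum>x\<in>D. \<Sum>x'\<in>D. w x' * w x * of_bool (x \<in> B x')) = (\<Sum>x\<in>D. \<Sum>x'\<in>D. w x * w x' * of_bool (x' \<in> B x))"
    by (rule sum.swap)
  also have "(\<Sum>x\<in>D. \<Sum>x'\<in>D. w x * w x' * of_bool (x' \<in> B x)) \<le> (\<Sum>x\<in>D. w x * exp (- 2 * real n * (p - d)\<^sup>2))"
  proof (rule sum_mono)
    fix x
    have "(\<Sum>x'\<in>D. w x' * of_bool (x' \<in> B x)) \<le> (\<Sum>x'\<in>B x. w x')"
      using fin by (simp add: sum.inter_filter[symmetric] of_bool_def if_distrib cong: if_cong)
        (intro sum_mono2; auto simp: B_def w)
    also have "\<dots> = measure_pmf.prob (source P n) (B x)"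
      by (simp add: prob B_def)
    also have "\<dots> \<le> exp (- 2 * real n * (p - d)\<^sup>2)"
      unfolding B_def by (rule prob_block_dist_le[OF P d n])
    finally have "w x * (\<Sum>x'\<in>D. w x' * of_bool (x' \<in> B x)) \<le> w x * exp (- 2 * real n * (p - d)\<^sup>2)"
      by (intro mult_left_mono w)
    then show "(\<Sum>x'\<in>D. w x * w x' * of_bool (x' \<in> B x)) \<le> w x * exp (- 2 * real n * (p - d)\<^sup>2)"
      by (simp add: sum_distrib_left mult.assoc)
  qed
  also have "(\<Sum>x\<in>D. w x * exp (- 2 * real n * (p - d)\<^sup>2)) = (\<Sum>x\<in>D. w x) * exp (- 2 * real n * (p - d)\<^sup>2)"
    by (rule sum_distrib_right[symmetric])
  finally have "(\<Sum>x\<in>D. w x) * (\<Sum>x\<in>D. w x) \<le> (\<Sum>x\<in>D. w x) * (2 * exp (- 2 * real n * (p - d)\<^sup>2))"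
    by linarith
  moreover have "(\<Sum>x\<in>D. w x) \<ge> 0"
    by (intro sum_nonneg w)
  ultimately have "(\<Sum>x\<in>D. w x) \<le> 2 * exp (- 2 * real n * (p - d)\<^sup>2)"
    by (cases "(\<Sum>x\<in>D. w x) = 0") (auto simp: mult_le_cancel_left)
  then show ?thesis
    using prob[OF fin] by (simp add: D_def)
qed

text \<open>For \<open>U 0 1 + U 1 0 = 0\<close> the set of optimal recovered sequences is the same for all types, and the
  worst response may be taken to be constant.\<close>

lemma prob_decoded_le_zero:
  fixes U :: "bit \<Rightarrow> bit \<Rightarrow> real" and P :: "bit pmf"
  assumes P: "pmf P 0 = p" "pmf P 1 = 1 - p" "p \<le> 1 / 2" and d: "d \<le> p" and n: "0 < n"
    and U: "U 0 0 = 0" "U 1 1 = 0" "U 0 1 + U 1 0 = 0"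
    and g: "g \<in> strategies n" and s: "s \<in> worst_responses P U d n g"
  shows "measure_pmf.prob (source P n) (decoded_set d n g s) \<le> exp (- 2 * real n * (p - d)\<^sup>2)"
proof -
  \<comment> \<open>The distance term vanishes, and in a difference of two reports the number of
    zeros of the type cancels. All types therefore rank the reports alike, and \<open>x0\<close>
    below may be any type.\<close>
  have gain: "block_utility U n y x' - block_utility U n y' x' = block_utility U n y x - block_utility U n y' x" for y y' x x'
    unfolding block_utility_eq_dist[of U, OF U(1,2)] U(3) by (simp add: algebra_simps diff_divide_distrib)
  have best: "s \<in> best_responses U n g"
    using s by (simp add: worst_responses_iff)
  define x0 :: "nat \<Rightarrow> bit" where "x0 = (\<lambda>_\<in>{..<n}. 0)"
  have x0: "x0 \<in> seqs n"
    by (auto simp: x0_def seqs_def)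
  have m: "s x0 \<in> seqs n"
    using best x0 g by (auto simp: best_responses_iff intro: strategies_in_seqs)
  define t :: "bit strategy" where "t = (\<lambda>_\<in>seqs n. s x0)"
  have t: "t \<in> best_responses U n g"
    unfolding best_responses_iff[OF g]
  proof (intro conjI ballI)
    show "t \<in> strategies n"
      using m by (auto simp: t_def strategies_def)
    fix x y :: "nat \<Rightarrow> bit"
    assume "x \<in> seqs n" "y \<in> g ` seqs n"
    then show "block_utility U n y x \<le> block_utility U n (g (t x)) x"
      using best x0 gain[of y x "g (s x0)" x0] unfolding best_responses_iff[OF g]
      by (fastforce simp: t_def)
  qed
  then have "measure_pmf.prob (source P n) (decoded_set d n g s) \<le> measure_pmf.prob (source P n) (decoded_set d n g t)"
    using s by (auto simp: worst_responses_iff error_prob_def)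
  also have "decoded_set d n g t = {x \<in> seqs n. block_dist n (g (s x0)) x \<le> d}"
    by (auto simp: decoded_set_def t_def)
  also have "measure_pmf.prob (source P n) \<dots> \<le> exp (- 2 * real n * (p - d)\<^sup>2)"
    by (rule prob_block_dist_le[OF P d n])
  finally show ?thesis .
qed

lemma not_achievable:
  fixes U :: "bit \<Rightarrow> bit \<Rightarrow> real" and P :: "bit pmf"
  assumes P: "pmf P 0 = p" "pmf P 1 = 1 - p" "p \<le> 1 / 2" and d: "d < p"
    and U: "U 0 0 = 0" "U 1 1 = 0" "U 0 1 + U 1 0 \<ge> 0"
  shows "\<not> achievable P U d R"
proof
  assume "achievable P U d R"
  then obtain g s \<epsilon> \<delta> where g: "\<And>n. n \<ge> 1 \<Longrightarrow> g n \<in> strategies n"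
    and s: "\<And>n. n \<ge> 1 \<Longrightarrow> s n \<in> worst_responses P U (d + \<delta> n) n (g n)"
    and err: "\<And>n. n \<ge> 1 \<Longrightarrow> error_prob P (d + \<delta> n) n (g n) (s n) < \<epsilon> n"
    and lim: "\<epsilon> \<longlonglongrightarrow> 0" "\<delta> \<longlonglongrightarrow> 0"
    unfolding achievable_def by blast
  \<comment> \<open>Half of the gap: eventually \<open>\<delta> n\<close> uses less than one half,
    and the other half drives the exponential decay.\<close>
  define c where "c = (p - d) / 2"
  have c: "c > 0" "d + c < p"
    using d by (simp_all add: c_def field_simps)
  have "(\<lambda>n. 2 * exp (- 2 * real n * c\<^sup>2)) \<longlonglongrightarrow> 0"
    using c(1) by real_asymp
  then have "\<forall>\<^sub>F n in sequentially. 2 * exp (- 2 * real n * c\<^sup>2) < 1 / 2"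
    by (rule order_tendstoD) simp
  moreover have "\<forall>\<^sub>F n in sequentially. \<epsilon> n < 1 / 2"
    using lim(1) by (rule order_tendstoD) simp
  moreover have "\<forall>\<^sub>F n in sequentially. \<delta> n < c"
    using lim(2) c(1) by (rule order_tendstoD)
  ultimately have "\<forall>\<^sub>F n in sequentially. False"
    using eventually_ge_at_top[of 1]
  proof eventually_elim
    case (elim n)
    have d': "d + \<delta> n \<le> p" "c \<le> p - (d + \<delta> n)"
      using elim(3) c by (simp_all add: c_def field_simps)
    have "measure_pmf.prob (source P n) (decoded_set (d + \<delta> n) n (g n) (s n))
      \<le> 2 * exp (- 2 * real n * (p - (d + \<delta> n))\<^sup>2)"
    proof (cases "U 0 1 + U 1 0 = 0")
      case True
      have "measure_pmf.prob (source P n) (decoded_set (d + \<delta> n) n (g n) (s n))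
        \<le> 1 * exp (- 2 * real n * (p - (d + \<delta> n))\<^sup>2)"
        using prob_decoded_le_zero[of P p "d + \<delta> n" n U "g n" "s n"] P U d' True elim g s by auto
      also have "\<dots> \<le> 2 * exp (- 2 * real n * (p - (d + \<delta> n))\<^sup>2)"
        by (intro mult_right_mono) auto
      finally show ?thesis .
    next
      case False
      then show ?thesis
        using prob_decoded_le_pos[of P p "d + \<delta> n" n U "g n" "s n"] P U d' elim g[of n] s[of n]
        by (auto simp: worst_responses_iff)
    qed
    also have "\<dots> \<le> 2 * exp (- 2 * real n * c\<^sup>2)"
      using d' c by (auto intro!: mult_left_mono power_mono)
    finally show False
      using elim err[of n] by (simp add: error_prob_def)
  qed
  then show False
    by simp
qed

section \<open>Codes\<close>

definition layer :: "nat \<Rightarrow> nat \<Rightarrow> (nat \<Rightarrow> bit) set" where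
  "layer n k = {x \<in> seqs n. card (zeros n x) = k}"

section \<open>Layers and their coverings\<close>

lemma card_sequences_with_zeros:
  assumes "C \<subseteq> Pow {..<n}"
  shows "card {x \<in> seqs n. zeros n x \<in> C} = card C"
proof -
  have "inj_on (zeros n) {x \<in> seqs n. zeros n x \<in> C}"
    by (rule inj_onI) (auto intro: zeros_inj)
  moreover have "zeros n ` {x \<in> seqs n. zeros n x \<in> C} = C"
  proof (intro equalityI subsetI)
    fix A
    assume "A \<in> C"
    then obtain x where "x \<in> seqs n" "zeros n x = A"
      using assms zeros_surj by blast
    then show "A \<in> zeros n ` {x \<in> seqs n. zeros n x \<in> C}"
      using \<open>A \<in> C\<close> by blast
  qed auto
  ultimately show ?thesis
    using card_image[of "zeros n" "{x \<in> seqs n. zeros n x \<in> C}"] by simp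
qed

lemma card_layer: "card (layer n k) = n choose k"
proof -
  have "layer n k = {x \<in> seqs n. zeros n x \<in> {A. A \<subseteq> {..<n} \<and> card A = k}}"
    using zeros_subset by (auto simp: layer_def)
  moreover have "card {x \<in> seqs n. zeros n x \<in> {A. A \<subseteq> {..<n} \<and> card A = k}} = card {A. A \<subseteq> {..<n} \<and> card A = k}"
    by (rule card_sequences_with_zeros) auto
  ultimately show ?thesis
    using n_subsets[of "{..<n}" k] by simp
qed

text \<open>Surplus zeros are deleted or missing ones added, so exactly the difference in the
  numbers of zeros is changed. This moves typical sequences into the one layer that a code
  covers.\<close>

lemma near_layer:
  assumes x: "x \<in> seqs n" and k: "k \<le> n"
  shows "\<exists>x'\<in>layer n k. block_dist n x' x = \<bar>real (card (zeros n x)) - real k\<bar> / n"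
proof (cases "k \<le> card (zeros n x)")
  case True
  then obtain A where A: "A \<subseteq> zeros n x" "card A = k" "finite A"
    using obtain_subset_with_card_n by metis
  moreover have "A \<subseteq> {..<n}"
    using A zeros_subset by blast
  then obtain x' where "x' \<in> seqs n" "zeros n x' = A"
    using zeros_surj by blast
  moreover have "A - zeros n x = {}" "card (zeros n x - A) = card (zeros n x) - k"
    using A by (auto simp: card_Diff_subset)
  ultimately have "x' \<in> layer n k" "block_dist n x' x = \<bar>real (card (zeros n x)) - real k\<bar> / n"
    using True by (simp_all add: layer_def block_dist_zeros of_nat_diff)
  then show ?thesis
    by blast
next
  case False
  then obtain A where A: "zeros n x \<subseteq> A" "A \<subseteq> {..<n}" "card A = k"
    using exists_subset_between[of "zeros n x" k "{..<n}"] k zeros_subset[of n x] by auto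
  moreover obtain x' where "x' \<in> seqs n" "zeros n x' = A"
    using A zeros_surj by blast
  moreover have "zeros n x - A = {}" "card (A - zeros n x) = k - card (zeros n x)"
    using A by (auto simp: card_Diff_subset)
  ultimately have "x' \<in> layer n k" "block_dist n x' x = \<bar>real (card (zeros n x)) - real k\<bar> / n"
    using False by (simp_all add: layer_def block_dist_zeros of_nat_diff)
  then show ?thesis
    by blast
qed

lemma typical_near_layer:
  assumes x: "x \<in> typical p n" and k: "k \<le> n" and n: "0 < n"
  shows "\<exists>x'\<in>layer n k. block_dist n x' x \<le> real n powr (- 1 / 4) + \<bar>p - k / n\<bar>"
proof -
  obtain x' where x': "x' \<in> layer n k" "block_dist n x' x = \<bar>real (card (zeros n x)) - real k\<bar> / n"
    using near_layer[of x n k] x k by (auto simp: typical_def)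
  have "\<bar>real (card (zeros n x)) - real k\<bar> \<le> real n powr (3 / 4) + \<bar>n * p - k\<bar>"
    using x by (auto simp: typical_def)
  then have "\<bar>real (card (zeros n x)) - real k\<bar> / n \<le> (real n powr (3 / 4) + \<bar>n * p - k\<bar>) / n"
    by (rule divide_right_mono) simp
  also have "\<dots> = real n powr (3 / 4) / n + \<bar>n * p - k\<bar> / real n"
    by (rule add_divide_distrib)
  also have "real n powr (3 / 4) / n = real n powr (- 1 / 4)"
    using n powr_diff[of "real n" "3 / 4" 1] by simp
  also have "\<bar>n * p - k\<bar> / real n = \<bar>(n * p - k) / n\<bar>"
    by (simp add: abs_divide)
  also have "(n * p - k) / n = p - k / n"
    using n by (simp add: diff_divide_distrib)
  finally show ?thesis
    using x' by (intro bexI[of _ x']) simp_all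
qed

lemma sequence_cover:
  assumes "m \<le> n" "j \<le> m" "l \<le> n - m"
  shows "\<exists>I \<subseteq> layer n m. I \<noteq> {} \<and> (\<forall>x\<in>layer n (m - j + l). \<exists>y\<in>I. block_dist n y x = (real j + real l) / n) \<and>
    real (card I) \<le> (real n + 1) * (real (n choose (m - j + l)) / (real (m choose j) * real ((n - m) choose l)))"
proof -
  obtain C where C: "C \<subseteq> {B. B \<subseteq> {..<n} \<and> card B = m}" "C \<noteq> {}"
    "\<forall>A. A \<subseteq> {..<n} \<and> card A = m - j + l \<longrightarrow> (\<exists>B\<in>C. card (A - B) + card (B - A) = j + l)"
    "real (card C) \<le> (real n + 1) * (real (n choose (m - j + l)) / (real (m choose j) * real ((n - m) choose l)))"
    using layer_cover[OF assms] by (elim exE conjE) (rule that)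
  define I where "I = {x \<in> seqs n. zeros n x \<in> C}"
  have seq: "\<exists>y\<in>I. zeros n y = B" if "B \<in> C" for B
    using C(1) that zeros_surj[of B n] by (auto simp: I_def)
  have "C \<subseteq> Pow {..<n}"
    using C(1) by auto
  then have "card I = card C"
    unfolding I_def by (rule card_sequences_with_zeros)
  moreover have "I \<subseteq> layer n m"
    using C(1) by (auto simp: I_def layer_def)
  moreover have "I \<noteq> {}"
    using C(2) seq by blast
  moreover have "\<exists>y\<in>I. block_dist n y x = (real j + real l) / n" if "x \<in> layer n (m - j + l)" for x
  proof -
    obtain B where B: "B \<in> C" "card (zeros n x - B) + card (B - zeros n x) = j + l"
      using C(3)[rule_format, of "zeros n x"] zeros_subset[of n x] \<open>x \<in> layer n (m - j + l)\<close>
      by (auto simp: layer_def)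
    obtain y where "y \<in> I" "zeros n y = B"
      using seq[OF B(1)] by auto
    moreover have "real (card (B - zeros n x)) + real (card (zeros n x - B)) = real j + real l"
      unfolding of_nat_add[symmetric] using B(2) by (simp add: add.commute)
    ultimately show ?thesis
      by (intro bexI[of _ y]) (simp_all add: block_dist_zeros)
  qed
  ultimately show ?thesis
    using C(4) by (intro exI[of _ I]) auto
qed

section \<open>Limits of rounded proportions\<close>

lemma tendsto_of_dist_le:
  fixes f g :: "nat \<Rightarrow> real"
  assumes "\<forall>\<^sub>F n in sequentially. \<bar>f n - c\<bar> \<le> g n" "g \<longlonglongrightarrow> 0"
  shows "f \<longlonglongrightarrow> c"
proof -
  have "(\<lambda>n. f n - c) \<longlonglongrightarrow> 0"
    by (rule Lim_null_comparison[OF _ assms(2)]) (use assms(1) in simp)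
  then show ?thesis
    by (rule LIM_zero_cancel)
qed

lemma nat_floor_bounds:
  fixes x :: real
  assumes "0 \<le> x"
  shows "real (nat \<lfloor>x\<rfloor>) \<le> x" "x - 1 < real (nat \<lfloor>x\<rfloor>)"
proof -
  have "real (nat \<lfloor>x\<rfloor>) = real_of_int \<lfloor>x\<rfloor>"
    using assms by simp
  then show "real (nat \<lfloor>x\<rfloor>) \<le> x" "x - 1 < real (nat \<lfloor>x\<rfloor>)"
    by linarith+
qed

lemma floor_ratio_tendsto:
  fixes f :: "nat \<Rightarrow> nat" and c :: real
  assumes f: "filterlim f at_top sequentially" and c: "0 \<le> c"
  shows "(\<lambda>n. real (nat \<lfloor>c * f n\<rfloor>) / real (f n)) \<longlonglongrightarrow> c"
proof (rule tendsto_of_dist_le)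
  have "(\<lambda>n. 1 / real n) \<longlonglongrightarrow> 0"
    by real_asymp
  then show "(\<lambda>n. 1 / real (f n)) \<longlonglongrightarrow> 0"
    using f by (rule filterlim_compose)
  have "\<forall>\<^sub>F n in sequentially. 1 \<le> f n"
    using f by (simp add: filterlim_at_top)
  then show "\<forall>\<^sub>F n in sequentially. \<bar>real (nat \<lfloor>c * f n\<rfloor>) / real (f n) - c\<bar> \<le> 1 / real (f n)"
  proof eventually_elim
    case (elim n)
    have "0 \<le> c * f n"
      using c by simp
    from nat_floor_bounds[OF this] have "\<bar>real (nat \<lfloor>c * f n\<rfloor>) - c * f n\<bar> \<le> 1"
      by linarith
    then have "\<bar>real (nat \<lfloor>c * f n\<rfloor>) - c * f n\<bar> / f n \<le> 1 / f n"
      by (rule divide_right_mono) simp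
    also have "\<bar>real (nat \<lfloor>c * f n\<rfloor>) - c * f n\<bar> / f n = \<bar>(real (nat \<lfloor>c * f n\<rfloor>) - c * f n) / f n\<bar>"
      by (simp add: abs_divide)
    also have "(real (nat \<lfloor>c * f n\<rfloor>) - c * f n) / f n = real (nat \<lfloor>c * f n\<rfloor>) / real (f n) - c"
      using elim by (simp add: diff_divide_distrib)
    finally show ?case .
  qed
qed

lemma filterlim_nat_at_top_of_ratio:
  fixes f :: "nat \<Rightarrow> nat"
  assumes "(\<lambda>n. real (f n) / real n) \<longlonglongrightarrow> c" "0 < c"
  shows "filterlim f at_top sequentially"
proof -
  have lim: "filterlim (\<lambda>n. real (f n) / real n * real n) at_top sequentially"
    by (rule filterlim_tendsto_pos_mult_at_top[OF assms filterlim_real_sequentially])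
  have eq: "\<forall>\<^sub>F n in sequentially. real (f n) / real n * real n = real (f n)"
    using eventually_gt_at_top[of 0] by eventually_elim simp
  have "filterlim (\<lambda>n. real (f n)) at_top sequentially"
    using lim unfolding filterlim_cong[OF refl refl eq] .
  then show ?thesis
    by (simp add: filterlim_sequentially_iff_filterlim_real)
qed

lemma lower_rate_tendsto:
  fixes \<delta> :: "nat \<Rightarrow> real"
  assumes "\<delta> \<longlonglongrightarrow> 0"
  shows "(\<lambda>n. c - \<delta> n * a - b * real n powr (- 1 / 4) - 1 / real n) \<longlonglongrightarrow> c"
proof -
  have "(\<lambda>n. real n powr (- 1 / 4)) \<longlonglongrightarrow> 0" "(\<lambda>n. 1 / real n) \<longlonglongrightarrow> 0"
    by real_asymp+
  then have "(\<lambda>n. c - \<delta> n * a - b * real n powr (- 1 / 4) - 1 / real n) \<longlonglongrightarrow> c - 0 * a - b * 0 - 0"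
    by (intro tendsto_intros assms)
  then show ?thesis
    by simp
qed

text \<open>Codewords have about \<open>n q\<close> zeros, where \<open>q\<close> is the output distribution of the optimal test channel:
  flipping a fraction \<open>\<theta>\<close> of all symbols of a codeword yields about \<open>n p\<close> zeros. As all codewords lie
  in one layer, the sender's utility is maximised by the nearest ones.\<close>

lemma achievable_entropy_diff:
  fixes U :: "bit \<Rightarrow> bit \<Rightarrow> real" and P :: "bit pmf"
  assumes P: "pmf P 0 = p" "pmf P 1 = 1 - p" and p: "p \<le> 1 / 2"
    and \<theta>: "0 < \<theta>" "\<theta> < p" "\<theta> \<le> d"
    and U: "U 0 0 = 0" "U 1 1 = 0" "U 0 1 + U 1 0 < 0"
  shows "achievable P U d (binary_entropy p - binary_entropy \<theta>)"
proof -
  define q where "q = (p - \<theta>) / (1 - 2 * \<theta>)"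
  have q: "0 < q" "q < 1"
    using p \<theta> by (simp_all add: q_def)
  have qp: "q * (1 - 2 * \<theta>) = p - \<theta>"
    using p \<theta> by (simp add: q_def)
  define m where "m n = nat \<lfloor>q * real n\<rfloor>" for n
  \<comment> \<open>Of a codeword's zeros \<open>j n\<close> are flipped, and of its ones
    \<open>l n\<close>, each a fraction \<theta> up to rounding; \<open>k n\<close> is the resulting
    number of zeros.\<close>
  define j where "j n = nat \<lfloor>\<theta> * real (m n)\<rfloor>" for n
  define l where "l n = nat \<lfloor>\<theta> * real (n - m n)\<rfloor>" for n
  define k where "k n = m n - j n + l n" for n
  \<comment> \<open>The first term moves a typical sequence towards n p zeros, the second dominates
    the rounding error 2 / n of \<open>kpn\<close>.\<close>
  define \<delta> where "\<delta> n = real n powr (- 1 / 4) + 3 / real n" for n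
  define low where "low n = (binary_entropy p - binary_entropy \<theta>) - \<delta> n * log 2 ((1 - \<theta>) / \<theta>)
    - log 2 ((1 - p) / p) * real n powr (- 1 / 4) - 1 / real n" for n
  define upp where "upp n = (log 2 (real n + 1) + log 2 (real (n choose k n)) - log 2 (real (m n choose j n))
    - log 2 (real ((n - m n) choose l n))) / real n" for n
  have le1: "nat \<lfloor>c * real i\<rfloor> \<le> i" if "0 \<le> c" "c \<le> 1" for c i
  proof -
    have "real (nat \<lfloor>c * real i\<rfloor>) \<le> c * real i"
      using that by (intro nat_floor_bounds) auto
    also have "\<dots> \<le> 1 * real i"
      using that by (intro mult_right_mono) auto
    finally show ?thesis
      by simp
  qed
  have le: "m n \<le> n" "j n \<le> m n" "l n \<le> n - m n" for n
    unfolding m_def j_def l_def using q p \<theta> by (intro le1; simp)+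
  then have kn: "k n \<le> n" for n
    unfolding k_def by (metis add_mono diff_le_self le_add_diff_inverse)
  have jl: "real (j n) + real (l n) \<le> \<theta> * n" for n
  proof -
    have "real (j n) \<le> \<theta> * real (m n)" "real (l n) \<le> \<theta> * real (n - m n)"
      unfolding j_def l_def using \<theta> by (intro nat_floor_bounds; simp)+
    then show ?thesis
      using le(1)[of n] by (simp add: of_nat_diff algebra_simps)
  qed
  \<comment> \<open>By \<open>qp\<close> exact proportions would give n p zeros. Rounding
    \<open>m n\<close> costs less than 1 after the factor 1 - 2 \<theta>; rounding
    \<open>j n\<close> and \<open>l n\<close> costs less than 1 each, with opposite signs.\<close>
  have kp: "\<bar>real n * p - real (k n)\<bar> \<le> 2" for n
  proof -
    have "real (m n) \<le> q * n" "q * n - 1 < real (m n)" "real (j n) \<le> \<theta> * real (m n)" "\<theta> * real (m n) - 1 < real (j n)"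
      "real (l n) \<le> \<theta> * real (n - m n)" "\<theta> * real (n - m n) - 1 < real (l n)"
      unfolding m_def j_def l_def using \<theta> q by (intro nat_floor_bounds; simp)+
    moreover have "real (k n) = real (m n) - real (j n) + real (l n)"
      using le(2)[of n] by (simp add: k_def of_nat_diff)
    moreover have "\<theta> * real (n - m n) = \<theta> * n - \<theta> * real (m n)"
      using le(1)[of n] by (simp add: of_nat_diff algebra_simps)
    moreover have "(1 - 2 * \<theta>) * real (m n) \<le> (1 - 2 * \<theta>) * (q * n)" "(1 - 2 * \<theta>) * (q * n - real (m n)) \<le> 1 * 1"
      using calculation(1,2) p \<theta> by (intro mult_left_mono mult_mono; simp)+
    moreover have "(1 - 2 * \<theta>) * (q * n) = n * p - \<theta> * n"
      using arg_cong[OF qp, of "\<lambda>t. t * n"] by (simp add: algebra_simps)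
    ultimately show ?thesis
      by (simp add: algebra_simps abs_le_iff)
  qed
  have kpn: "\<bar>p - k n / n\<bar> \<le> 2 / n" if "0 < n" for n
  proof -
    have "p - k n / n = (n * p - k n) / n"
      using that by (simp add: diff_divide_distrib)
    then show ?thesis
      using kp[of n] by (simp add: abs_divide divide_right_mono)
  qed
  define J where "J = (\<lambda>n I. I \<subseteq> layer n (m n) \<and> I \<noteq> {} \<and>
    (\<forall>x\<in>layer n (k n). \<exists>y\<in>I. block_dist n y x = (real (j n) + real (l n)) / n) \<and>
    real (card I) \<le> (real n + 1) * (real (n choose (k n)) / (real (m n choose j n) * real ((n - m n) choose l n))))"
  have "\<exists>I. J n I" for n
    using sequence_cover[OF le, of n] unfolding J_def k_def by blast
  then obtain I where "\<And>n. J n (I n)"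
    by metis
  then have I: "\<And>n. I n \<subseteq> layer n (m n)" "\<And>n. I n \<noteq> {}"
    "\<And>n x. x \<in> layer n (k n) \<Longrightarrow> \<exists>y\<in>I n. block_dist n y x = (real (j n) + real (l n)) / n"
    "\<And>n. real (card (I n)) \<le> (real n + 1) * (real (n choose (k n)) / (real (m n choose j n) * real ((n - m n) choose l n)))"
    unfolding J_def by blast+
  have dec: "typical p n \<subseteq> decoded_set (\<theta> + \<delta> n) n g s"
    if n: "0 < n" and g: "g \<in> strategies n" "g ` seqs n = I n" and s: "s \<in> best_responses U n g" for n g s
  proof
    fix x
    assume x: "x \<in> typical p n"
    then have xs: "x \<in> seqs n"
      by (simp add: typical_def)
    obtain x' where x': "x' \<in> layer n (k n)" "block_dist n x' x \<le> real n powr (- 1 / 4) + \<bar>p - k n / n\<bar>"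
      using typical_near_layer[OF x kn n] by auto
    obtain y where y: "y \<in> I n" "block_dist n y x' = (real (j n) + real (l n)) / n"
      using I(3)[OF x'(1)] by auto
    have "block_dist n (g (s x)) x \<le> block_dist n y x"
      using I(1)[of n] y(1) by (intro best_response_nearest[where m = "m n", OF U g(1) s _ xs]) (auto simp: g(2) layer_def)
    also have "\<dots> \<le> block_dist n y x' + block_dist n x' x"
      by (rule block_dist_triangle)
    also have "block_dist n y x' \<le> \<theta>"
      using y(2) jl[of n] n by (simp add: divide_le_eq)
    also have "block_dist n x' x \<le> \<delta> n"
    proof -
      have "2 / real n \<le> 3 / real n"
        by (intro divide_right_mono) auto
      then show ?thesis
        using x'(2) kpn[OF n] by (simp add: \<delta>_def)
    qed
    finally show "x \<in> decoded_set (\<theta> + \<delta> n) n g s"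
      using xs by (simp add: decoded_set_def)
  qed
  \<comment> \<open>The code works already at level \<theta>, which gives the lower bound on its
    rate; achievability is claimed at level \<open>d\<close>.\<close>
  have mono: "decoded_set (\<theta> + \<delta> n) n g s \<subseteq> decoded_set (d + \<delta> n) n g s" for n and g s :: "bit strategy"
    using \<theta>(3) by (auto simp: decoded_set_def)
  show ?thesis
  proof (rule achievable_by_images[where \<delta> = \<delta> and I = I and l = low and u = upp, OF P(1)])
    show "0 < \<delta> n" if "0 < n" for n
      using that by (simp add: \<delta>_def add_pos_pos)
    show \<delta>0: "\<delta> \<longlonglongrightarrow> 0"
      unfolding \<delta>_def by real_asymp
    show "I n \<subseteq> seqs n" "I n \<noteq> {}" for n
      using I(1,2)[of n] by (auto simp: layer_def)
    show "typical p n \<subseteq> decoded_set (d + \<delta> n) n g s"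
      if "0 < n" "g \<in> strategies n" "g ` seqs n = I n" "s \<in> best_responses U n g" for n g s
      using dec[OF that] mono by blast
    show "low \<longlonglongrightarrow> binary_entropy p - binary_entropy \<theta>"
      unfolding low_def by (rule lower_rate_tendsto[OF \<delta>0])
    have "(\<lambda>n. 2 * exp (- 2 * sqrt (real n)) + 2 * exp (- 2 * sqrt (real n))) \<longlonglongrightarrow> 0"
      by real_asymp
    then have "\<forall>\<^sub>F n in sequentially. 2 * exp (- 2 * sqrt (real n)) + 2 * exp (- 2 * sqrt (real n)) < 1 / 2"
      by (rule order_tendstoD) simp
    then show "\<forall>\<^sub>F n in sequentially. \<forall>g s. g \<in> strategies n \<longrightarrow> g ` seqs n = I n \<longrightarrow> s \<in> best_responses U n g \<longrightarrow>
      low n \<le> block_rate (d + \<delta> n) n g s \<and> block_rate (d + \<delta> n) n g s \<le> upp n"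
      using eventually_gt_at_top[of 0]
    proof eventually_elim
      case (elim n)
      show ?case
      proof (intro allI impI conjI)
        fix g s
        assume g: "g \<in> strategies n" "g ` seqs n = I n" and s: "s \<in> best_responses U n g"
        have "error_prob P (\<theta> + \<delta> n) n g s \<le> 2 * exp (- 2 * sqrt n)"
          by (rule error_prob_le[OF P(1) elim(2) dec[OF elim(2) g s]])
        then have "binary_entropy p - binary_entropy \<theta> - (\<theta> + \<delta> n - \<theta>) * log 2 ((1 - \<theta>) / \<theta>)
            - log 2 ((1 - p) / p) * real n powr (- 1 / 4) - 1 / n \<le> block_rate (\<theta> + \<delta> n) n g s"
          using elim s p \<theta> by (intro block_rate_ge[OF P]) (auto simp: best_responses_def)
        also have "\<dots> \<le> block_rate (d + \<delta> n) n g s"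
          using \<theta>(3) by (intro block_rate_mono) simp
        finally show "low n \<le> block_rate (d + \<delta> n) n g s"
          by (simp add: low_def)
        define X where "X = (real n + 1) * (real (n choose (k n)) / (real (m n choose j n) * real ((n - m n) choose l n)))"
        have "finite (I n)"
          using I(1)[of n] finite_subset[of "I n" "seqs n"] by (auto simp: layer_def)
        then have "card (I n) > 0"
          using I(2)[of n] by (simp add: card_gt_0_iff)
        then have X: "real (card (I n)) \<le> X" "1 \<le> X"
          using I(4)[of n] unfolding X_def by linarith+
        then have "block_rate (d + \<delta> n) n g s \<le> log 2 X / n"
          by (intro block_rate_le_image) (simp_all add: g)
        moreover have "log 2 X = log 2 (real n + 1) + log 2 (real (n choose k n)) - log 2 (real (m n choose j n))
            - log 2 (real ((n - m n) choose l n))"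
        proof -
          have pos: "0 < real (n choose k n)" "0 < real (m n choose j n)" "0 < real ((n - m n) choose l n)"
            using le[of n] kn[of n] by simp_all
          have "log 2 (a * (b / (c * e))) = log 2 a + log 2 b - log 2 c - log 2 e"
            if "0 < a" "0 < b" "0 < c" "0 < e" for a b c e :: real
            using that by (simp add: log_mult log_divide)
          then show ?thesis
            unfolding X_def using pos by simp
        qed
        ultimately show "block_rate (d + \<delta> n) n g s \<le> upp n"
          by (simp add: upp_def)
      qed
    qed
    have id: "filterlim (\<lambda>n::nat. n) at_top sequentially"
      by (rule filterlim_ident)
    have mlim: "(\<lambda>n. real (m n) / real n) \<longlonglongrightarrow> q"
      using floor_ratio_tendsto[OF id, of q] q by (simp add: m_def)
    have nm: "\<forall>\<^sub>F n in sequentially. 1 - real (m n) / real n = real (n - m n) / real n"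
      using eventually_gt_at_top[of 0]
      by eventually_elim (use le(1) in \<open>simp add: of_nat_diff field_simps\<close>)
    have "(\<lambda>n. 1 - real (m n) / real n) \<longlonglongrightarrow> 1 - q"
      by (intro tendsto_intros mlim)
    then have nmlim: "(\<lambda>n. real (n - m n) / real n) \<longlonglongrightarrow> 1 - q"
      by (rule Lim_transform_eventually[OF _ nm])
    have mtop: "filterlim m at_top sequentially" "filterlim (\<lambda>n. n - m n) at_top sequentially"
      using filterlim_nat_at_top_of_ratio[OF mlim] filterlim_nat_at_top_of_ratio[OF nmlim] q by auto
    have klim: "(\<lambda>n. real (k n) / real n) \<longlonglongrightarrow> p"
    proof (rule tendsto_of_dist_le)
      show "\<forall>\<^sub>F n in sequentially. \<bar>real (k n) / real n - p\<bar> \<le> 2 / real n"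
        using eventually_gt_at_top[of 0] by eventually_elim (use kpn in \<open>simp add: abs_minus_commute\<close>)
      show "(\<lambda>n. 2 / real n) \<longlonglongrightarrow> 0"
        by real_asymp
    qed
    have "(\<lambda>n. log 2 (real (m n choose j n)) / real (m n)) \<longlonglongrightarrow> binary_entropy \<theta>"
      unfolding j_def using floor_ratio_tendsto[OF mtop(1), of \<theta>] \<theta> p by (intro log_choose_tendsto mtop) auto
    moreover have "(\<lambda>n. log 2 (real ((n - m n) choose l n)) / real (n - m n)) \<longlonglongrightarrow> binary_entropy \<theta>"
      unfolding l_def using floor_ratio_tendsto[OF mtop(2), of \<theta>] \<theta> p by (intro log_choose_tendsto mtop) auto
    moreover have "(\<lambda>n. log 2 (real (n choose k n)) / real n) \<longlonglongrightarrow> binary_entropy p"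
      using klim \<theta> p by (intro log_choose_tendsto id) auto
    moreover have "(\<lambda>n. log 2 (real n + 1) / real n) \<longlonglongrightarrow> 0"
      by real_asymp
    \<comment> \<open>Each logarithm is normalised by its own block, the zeros or the ones of a
      codeword. Their shares q and 1 - q recombine to one copy of
      \<open>binary_entropy \<theta>\<close>.\<close>
    ultimately have "(\<lambda>n. log 2 (real n + 1) / real n + log 2 (real (n choose k n)) / real n
        - log 2 (real (m n choose j n)) / real (m n) * (real (m n) / real n)
        - log 2 (real ((n - m n) choose l n)) / real (n - m n) * (real (n - m n) / real n))
      \<longlonglongrightarrow> 0 + binary_entropy p - binary_entropy \<theta> * q - binary_entropy \<theta> * (1 - q)"
      by (intro tendsto_intros mlim nmlim)
    moreover have "\<forall>\<^sub>F n in sequentially. log 2 (real n + 1) / real n + log 2 (real (n choose k n)) / real n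
        - log 2 (real (m n choose j n)) / real (m n) * (real (m n) / real n)
        - log 2 (real ((n - m n) choose l n)) / real (n - m n) * (real (n - m n) / real n) = upp n"
    proof -
      have "\<forall>\<^sub>F n in sequentially. 1 \<le> m n" "\<forall>\<^sub>F n in sequentially. 1 \<le> n - m n"
        using mtop by (simp_all add: filterlim_at_top)
      then show ?thesis
      proof eventually_elim
        case (elim n)
        have cancel: "x / a * (a / b) = x / b" if "a \<noteq> 0" for x a b :: real
          using that by simp
        have nz: "real (m n) \<noteq> 0" "real (n - m n) \<noteq> 0"
          using elim by linarith+
        show ?case
          by (simp only: cancel[OF nz(1)] cancel[OF nz(2)] upp_def add_divide_distrib diff_divide_distrib)
      qed
    qed
    ultimately have "upp \<longlonglongrightarrow> 0 + binary_entropy p - binary_entropy \<theta> * q - binary_entropy \<theta> * (1 - q)"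
      by (rule Lim_transform_eventually)
    then show "upp \<longlonglongrightarrow> binary_entropy p - binary_entropy \<theta>"
      by (simp add: algebra_simps)
  qed
qed

section \<open>Codes whose elements are reported truthfully\<close>

lemma recovered_set_eq_image:
  assumes g: "g \<in> strategies n" and d: "0 \<le> d" and truthful: "\<And>y. y \<in> g ` seqs n \<Longrightarrow> g (s y) = y"
  shows "recovered_set d n g s = g ` seqs n"
proof -
  have "y \<in> decoded_set d n g s" if "y \<in> g ` seqs n" for y
    using that d truthful[OF that] strategies_in_seqs[OF g] by (auto simp: decoded_set_def)
  then show ?thesis
    using truthful by (force simp: recovered_set_def)
qed

text \<open>A type inside the layer has itself as its only nearest codeword. All codewords are thus
  recovered and the rate is exactly that of a binomial coefficient. Typical sequences are within
  about \<bar>p - t\<bar> of the layer.\<close>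

lemma achievable_layer_entropy:
  fixes U :: "bit \<Rightarrow> bit \<Rightarrow> real" and P :: "bit pmf"
  assumes P: "pmf P 0 = p" and d: "0 \<le> d" and t: "0 < t" "t < 1" "\<bar>p - t\<bar> \<le> d"
    and U: "U 0 0 = 0" "U 1 1 = 0" "U 0 1 + U 1 0 < 0"
  shows "achievable P U d (binary_entropy t)"
proof -
  define m where "m n = nat \<lfloor>t * real n\<rfloor>" for n
  define \<delta> where "\<delta> n = real n powr (- 1 / 4) + 1 / real n" for n
  define r where "r n = log 2 (real (n choose m n)) / real n" for n
  have mb: "real (m n) \<le> t * n" "t * n - 1 < real (m n)" for n
    unfolding m_def using t by (intro nat_floor_bounds; simp)+
  have mn: "m n \<le> n" for n
  proof -
    have "real (m n) \<le> 1 * real n"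
      using mb(1)[of n] t mult_right_mono[of t 1 "real n"] by linarith
    then show ?thesis
      by simp
  qed
  have mt: "\<bar>p - m n / n\<bar> \<le> d + 1 / n" if "0 < n" for n
  proof -
    have "\<bar>t * n - m n\<bar> \<le> 1"
      using mb[of n] by simp
    then have "\<bar>t * n - m n\<bar> / n \<le> 1 / n"
      by (rule divide_right_mono) simp
    then have "\<bar>(t * n - m n) / n\<bar> \<le> 1 / n"
      by (simp add: abs_divide)
    moreover have "(t * n - m n) / n = t - m n / n"
      using that by (simp add: diff_divide_distrib)
    ultimately show ?thesis
      using t(3) by linarith
  qed
  have \<delta>pos: "0 < \<delta> n" if "0 < n" for n
    using that by (simp add: \<delta>_def add_pos_pos)
  have near: "block_dist n (g (s x)) x \<le> block_dist n y x"
    if g: "g \<in> strategies n" "g ` seqs n = layer n (m n)" and s: "s \<in> best_responses U n g"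
      and xy: "x \<in> seqs n" "y \<in> layer n (m n)" for n g s x y
  proof (rule best_response_nearest[where m = "m n", OF U g(1) s _ xy(1)])
    show "card (zeros n y') = m n" if "y' \<in> g ` seqs n" for y'
      using that unfolding g(2) by (simp add: layer_def)
    show "y \<in> g ` seqs n"
      unfolding g(2) by (rule xy(2))
  qed
  show ?thesis
  proof (rule achievable_by_images[where \<delta> = \<delta> and I = "\<lambda>n. layer n (m n)" and l = r and u = r, OF P(1) \<delta>pos])
    show "\<delta> \<longlonglongrightarrow> 0"
      unfolding \<delta>_def by real_asymp
    show "layer n (m n) \<subseteq> seqs n" for n
      by (auto simp: layer_def)
    show "layer n (m n) \<noteq> {}" for n
    proof -
      have "card (layer n (m n)) > 0"
        using mn[of n] by (simp add: card_layer)
      then show ?thesis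
        by auto
    qed
    show "typical p n \<subseteq> decoded_set (d + \<delta> n) n g s"
      if n: "0 < n" and g: "g \<in> strategies n" "g ` seqs n = layer n (m n)" and s: "s \<in> best_responses U n g" for n g s
    proof
      fix x
      assume x: "x \<in> typical p n"
      then have xs: "x \<in> seqs n"
        by (simp add: typical_def)
      obtain y where y: "y \<in> layer n (m n)" "block_dist n y x \<le> real n powr (- 1 / 4) + \<bar>p - m n / n\<bar>"
        using typical_near_layer[OF x mn n] by auto
      have "block_dist n (g (s x)) x \<le> d + \<delta> n"
        using near[OF g s xs y(1)] y(2) mt[OF n] by (simp add: \<delta>_def)
      then show "x \<in> decoded_set (d + \<delta> n) n g s"
        using xs by (simp add: decoded_set_def)
    qed
    show "\<forall>\<^sub>F n in sequentially. \<forall>g s. g \<in> strategies n \<longrightarrow> g ` seqs n = layer n (m n) \<longrightarrow> s \<in> best_responses U n g \<longrightarrow>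
      r n \<le> block_rate (d + \<delta> n) n g s \<and> block_rate (d + \<delta> n) n g s \<le> r n"
      using eventually_gt_at_top[of 0]
    proof eventually_elim
      case (elim n)
      show ?case
      proof (intro allI impI)
        fix g s
        assume g: "g \<in> strategies n" "g ` seqs n = layer n (m n)" and s: "s \<in> best_responses U n g"
        have "recovered_set (d + \<delta> n) n g s = g ` seqs n"
        proof (rule recovered_set_eq_image[OF g(1)])
          show "0 \<le> d + \<delta> n"
            using d \<delta>pos[OF elim] by simp
          fix y
          assume y: "y \<in> g ` seqs n"
          then have ys: "y \<in> seqs n"
            unfolding g(2) by (simp add: layer_def)
          have "block_dist n (g (s y)) y \<le> 0"
            using near[OF g s ys, of y] y g(2) by simp
          then have "block_dist n (g (s y)) y = 0"
            using block_dist_nonneg[of n "g (s y)" y] by simp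
          moreover have "s y \<in> seqs n"
            using s ys strategies_in_seqs[of s n y] by (simp add: best_responses_def)
          ultimately show "g (s y) = y"
            by (intro block_dist_eq_0D[OF _ elim ys] strategies_in_seqs[OF g(1)])
        qed
        then show "r n \<le> block_rate (d + \<delta> n) n g s \<and> block_rate (d + \<delta> n) n g s \<le> r n"
          by (simp add: block_rate_def r_def g(2) card_layer)
      qed
    qed
    have "r \<longlonglongrightarrow> binary_entropy t"
      unfolding r_def m_def
      using floor_ratio_tendsto[OF filterlim_ident, of t] t by (intro log_choose_tendsto[OF filterlim_ident]) auto
    then show "r \<longlonglongrightarrow> binary_entropy t" "r \<longlonglongrightarrow> binary_entropy t"
      by auto
  qed
qed

text \<open>If both mistakes hurt the sender, every recovered sequence is reported truthfully by its own type, so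
  that arbitrary further sequences may be added to an image that contains the typical ones.\<close>

lemma achievable_above_entropy:
  fixes U :: "bit \<Rightarrow> bit \<Rightarrow> real" and P :: "bit pmf"
  assumes P: "pmf P 0 = p" "pmf P 1 = 1 - p" and p: "0 < p" "p \<le> 1 / 2" and d: "0 \<le> d"
    and U: "U 0 0 = 0" "U 1 1 = 0" "U 0 1 < 0" "U 1 0 < 0"
    and R: "binary_entropy p \<le> R" "0 \<le> R" "R \<le> 1"
  shows "achievable P U d R"
proof -
  define K where "K = log 2 ((1 - p) / p)"
  have K: "0 \<le> K"
    using p by (simp add: K_def)
  \<comment> \<open>The image must contain the typical set, which may exceed 2^(nR) when R is close
    to the entropy, but only by a factor that is subexponential in \<open>n\<close>.\<close>
  define N where "N n = max (card (typical p n)) (nat \<lfloor>2 powr (n * R)\<rfloor>)" for n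
  define \<delta> where "\<delta> n = 1 / real n" for n
  define low where "low n = R - 1 / real n" for n
  define upp where "upp n = R + K * real n powr (- 1 / 4)" for n
  \<comment> \<open>As the power is at least 1, the floor loses at most a factor 2, that is 1 / n in
    the rate.\<close>
  have fl: "1 \<le> 2 powr (n * R)" "real (nat \<lfloor>2 powr (n * R)\<rfloor>) \<le> 2 powr (n * R)" "2 powr (n * R) / 2 \<le> real (nat \<lfloor>2 powr (n * R)\<rfloor>)" for n :: nat
  proof -
    show 1: "1 \<le> 2 powr (n * R)"
      using R by (simp add: ge_one_powr_ge_zero)
    show "real (nat \<lfloor>2 powr (n * R)\<rfloor>) \<le> 2 powr (n * R)"
      by (rule nat_floor_bounds) simp
    have "1 \<le> \<lfloor>2 powr (n * R)\<rfloor>"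
      using 1 by (simp add: le_floor_iff)
    then show "2 powr (n * R) / 2 \<le> real (nat \<lfloor>2 powr (n * R)\<rfloor>)"
      by linarith
  qed
  have "\<exists>I. typical p n \<subseteq> I \<and> I \<subseteq> seqs n \<and> card I = N n" for n
  proof -
    have sub: "typical p n \<subseteq> seqs n"
      by (auto simp: typical_def)
    have "real (nat \<lfloor>2 powr (n * R)\<rfloor>) \<le> 2 powr (n * R)"
      by (rule fl)
    also have "\<dots> \<le> 2 powr real n"
      using R by (intro powr_mono mult_left_le) auto
    also have "\<dots> = real (2 ^ n)"
      by (simp add: powr_realpow)
    finally have "nat \<lfloor>2 powr (n * R)\<rfloor> \<le> 2 ^ n"
      by (simp only: of_nat_le_iff)
    then have "N n \<le> card (seqs n :: (nat \<Rightarrow> bit) set)"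
      using card_mono[OF finite_seqs sub] by (simp add: N_def card_seqs)
    then show ?thesis
      using exists_subset_between[of "typical p n" "N n" "seqs n"] sub by (auto simp: N_def)
  qed
  then obtain I where I: "\<And>n. typical p n \<subseteq> I n" "\<And>n. I n \<subseteq> seqs n" "\<And>n. card (I n) = N n"
    by metis
  have N: "2 powr (n * R) / 2 \<le> real (N n)" "real (N n) \<le> 2 powr (n * R + K * real n powr (3 / 4))" for n
  proof -
    show "2 powr (n * R) / 2 \<le> real (N n)"
      using fl(3)[of n] by (simp add: N_def)
    have "real (card (typical p n)) \<le> 2 powr (n * binary_entropy p + K * real n powr (3 / 4))"
      unfolding K_def by (rule card_typical_le[OF P p])
    also have "\<dots> \<le> 2 powr (n * R + K * real n powr (3 / 4))"
      using R by (intro powr_mono add_right_mono mult_left_mono) auto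
    finally have "real (card (typical p n)) \<le> 2 powr (n * R + K * real n powr (3 / 4))" .
    moreover have pow: "2 powr (n * R) \<le> 2 powr (n * R + K * real n powr (3 / 4))"
      using K by (intro powr_mono) auto
    ultimately show "real (N n) \<le> 2 powr (n * R + K * real n powr (3 / 4))"
      unfolding N_def of_nat_max by (intro max.boundedI order_trans[OF fl(2) pow])
  qed
  have Npos: "0 < N n" for n
    using N(1)[of n] fl(1)[of n] by linarith
  have exact: "g (s x) = x"
    if "0 < n" "g \<in> strategies n" "g ` seqs n = I n" "s \<in> best_responses U n g" "x \<in> I n" for n g s x
    using best_response_exact[OF U that(1,2,4)] I(2)[of n] that(3,5) by blast
  show ?thesis
  proof (rule achievable_by_images[where \<delta> = \<delta> and I = I and l = low and u = upp, OF P(1)])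
    show "0 < \<delta> n" if "0 < n" for n
      using that by (simp add: \<delta>_def)
    show "\<delta> \<longlonglongrightarrow> 0"
      unfolding \<delta>_def by real_asymp
    show "I n \<subseteq> seqs n" for n
      by (rule I)
    show "I n \<noteq> {}" for n
      using I(3)[of n] Npos[of n] by auto
    show "typical p n \<subseteq> decoded_set (d + \<delta> n) n g s"
      if n: "0 < n" and g: "g \<in> strategies n" "g ` seqs n = I n" and s: "s \<in> best_responses U n g" for n g s
    proof
      fix x
      assume "x \<in> typical p n"
      then have "x \<in> I n" "x \<in> seqs n"
        using I by auto
      then show "x \<in> decoded_set (d + \<delta> n) n g s"
        using exact[OF n g s, of x] d by (simp add: decoded_set_def \<delta>_def)
    qed
    show "\<forall>\<^sub>F n in sequentially. \<forall>g s. g \<in> strategies n \<longrightarrow> g ` seqs n = I n \<longrightarrow> s \<in> best_responses U n g \<longrightarrow>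
      low n \<le> block_rate (d + \<delta> n) n g s \<and> block_rate (d + \<delta> n) n g s \<le> upp n"
      using eventually_gt_at_top[of 0]
    proof eventually_elim
      case (elim n)
      have rate: "block_rate (d + \<delta> n) n g s = log 2 (N n) / n"
        if g: "g \<in> strategies n" "g ` seqs n = I n" and s: "s \<in> best_responses U n g" for g s
      proof -
        have "recovered_set (d + \<delta> n) n g s = g ` seqs n"
          using exact[OF elim g s] d by (intro recovered_set_eq_image g) (auto simp: g(2) \<delta>_def)
        then show ?thesis
          by (simp add: block_rate_def g(2) I(3))
      qed
      have "log 2 (2 powr (n * R) / 2) \<le> log 2 (N n)"
        using N(1)[of n] by (intro log_mono) auto
      then have "(n * R - 1) / n \<le> log 2 (N n) / n"
        by (intro divide_right_mono) (auto simp: log_divide)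
      then have "low n \<le> log 2 (N n) / n"
        using elim by (simp add: low_def diff_divide_distrib)
      moreover have "log 2 (N n) \<le> log 2 (2 powr (n * R + K * real n powr (3 / 4)))"
        using N(2)[of n] Npos[of n] by (intro log_mono) auto
      then have "log 2 (N n) / n \<le> (n * R + K * real n powr (3 / 4)) / n"
        by (intro divide_right_mono) auto
      moreover have "(n * R + K * real n powr (3 / 4)) / n = R + K * (real n powr (3 / 4) / n)"
        using elim by (simp add: add_divide_distrib)
      moreover have "real n powr (3 / 4) / n = real n powr (- 1 / 4)"
        using elim powr_diff[of "real n" "3 / 4" 1] by simp
      ultimately show ?case
        using rate by (auto simp: upp_def)
    qed
    have lims: "(\<lambda>n. real n powr (- 1 / 4)) \<longlonglongrightarrow> 0" "(\<lambda>n. 1 / real n) \<longlonglongrightarrow> 0"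
      by real_asymp+
    have "low \<longlonglongrightarrow> R - 0" "upp \<longlonglongrightarrow> R + K * 0"
      unfolding low_def upp_def by (intro tendsto_intros lims)+
    then show "low \<longlonglongrightarrow> R" "upp \<longlonglongrightarrow> R"
      by simp_all
  qed
qed

text \<open>A receiver that always answers with the all-ones sequence leaves the sender no
  influence. Its distance to a typical sequence is the fraction of zeros, about
  \<open>p\<close>.\<close>

lemma achievable_0:
  fixes P :: "bit pmf"
  assumes P: "pmf P 0 = p" and d: "p \<le> d"
  shows "achievable P U d 0"
proof -
  define one :: "nat \<Rightarrow> nat \<Rightarrow> bit" where "one n = (\<lambda>_\<in>{..<n}. 1)" for n
  have one: "one n \<in> seqs n" "zeros n (one n) = {}" for n
    by (auto simp: one_def seqs_def zeros_def)
  define \<delta> where "\<delta> n = real n powr (- 1 / 4)" for n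
  show ?thesis
  proof (rule achievable_by_images[where \<delta> = \<delta> and I = "\<lambda>n. {one n}" and l = "\<lambda>_. 0" and u = "\<lambda>_. 0", OF P(1)])
    show "0 < \<delta> n" if "0 < n" for n
      using that by (simp add: \<delta>_def)
    show "\<delta> \<longlonglongrightarrow> 0"
      unfolding \<delta>_def by real_asymp
    show "typical p n \<subseteq> decoded_set (d + \<delta> n) n g s"
      if n: "0 < n" and g: "g \<in> strategies n" "g ` seqs n = {one n}" and s: "s \<in> best_responses U n g" for n g s
    proof
      fix x
      assume x: "x \<in> typical p n"
      then have xs: "x \<in> seqs n"
        by (simp add: typical_def)
      then have "s x \<in> seqs n"
        using s by (auto simp: best_responses_def intro: strategies_in_seqs)
      then have gs: "g (s x) = one n"
        using g(2) by auto
      have "card (zeros n x) / n \<le> (n * p + real n powr (3 / 4)) / n"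
        using x by (intro divide_right_mono) (auto simp: typical_def)
      moreover have "real n powr (3 / 4) / n = real n powr (- 1 / 4)"
        using n powr_diff[of "real n" "3 / 4" 1] by simp
      then have "(n * p + real n powr (3 / 4)) / n = p + \<delta> n"
        using n by (simp add: \<delta>_def add_divide_distrib)
      ultimately have "block_dist n (g (s x)) x \<le> d + \<delta> n"
        unfolding gs block_dist_zeros using d by (simp add: one)
      then show "x \<in> decoded_set (d + \<delta> n) n g s"
        using xs by (simp add: decoded_set_def)
    qed
    show "\<forall>\<^sub>F n in sequentially. \<forall>g s. g \<in> strategies n \<longrightarrow> g ` seqs n = {one n} \<longrightarrow> s \<in> best_responses U n g \<longrightarrow>
      0 \<le> block_rate (d + \<delta> n) n g s \<and> block_rate (d + \<delta> n) n g s \<le> 0"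
    proof (intro always_eventually allI impI)
      fix n and g s :: "bit strategy"
      assume "g ` seqs n = {one n}"
      then show "0 \<le> block_rate (d + \<delta> n) n g s \<and> block_rate (d + \<delta> n) n g s \<le> 0"
        using block_rate_le_image[of g n 1 "d + \<delta> n" s] by (simp add: block_rate_nonneg)
    qed
  qed (auto simp: one)
qed

text \<open>This supplies the level \<theta> at which the covering code has a prescribed rate
  between those at \<open>d\<close> and at 0.\<close>

lemma binary_entropy_interpolate:
  assumes d: "0 < d" "d < 1" and c: "0 < c" "c \<le> binary_entropy d"
  obtains \<theta> where "0 < \<theta>" "\<theta> \<le> d" "binary_entropy \<theta> = c"
proof -
  \<comment> \<open>Continuity is available only in the open interval, so the intermediate value
    theorem is started at a point \<open>e\<close> to the right of 0.\<close>
  have "(binary_entropy \<longlongrightarrow> 0) (at_right 0)"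
    unfolding binary_entropy_def by real_asymp
  then have "\<forall>\<^sub>F t in at_right 0. binary_entropy t < c"
    using c(1) by (rule order_tendstoD)
  moreover have "\<forall>\<^sub>F t in at_right 0. t \<in> {0<..<d}"
    using d(1) by (rule eventually_at_right_real)
  ultimately have "\<forall>\<^sub>F t in at_right 0. binary_entropy t < c \<and> t \<in> {0<..<d}"
    by (rule eventually_conj)
  then obtain e where e: "binary_entropy e < c" "0 < e" "e < d"
    using eventually_happens[of _ "at_right (0::real)"] by (auto simp: trivial_limit_at_right_real)
  have "continuous_on {e..d} binary_entropy"
    using e d by (intro continuous_at_imp_continuous_on ballI isCont_binary_entropy) auto
  then obtain \<theta> where "e \<le> \<theta>" "\<theta> \<le> d" "binary_entropy \<theta> = c"
    using IVT'[of binary_entropy e c d] e c by auto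
  then show thesis
    using e by (intro that[of \<theta>]) auto
qed

theorem mainTheorem2:
  fixes P :: "bit pmf" and U :: "bit \<Rightarrow> bit \<Rightarrow> real" and p d :: real
  assumes "pmf P 0 = p" and "pmf P 1 = 1 - p" and "p \<le> 1 / 2"
    and "U 0 0 = 0" and "U 1 1 = 0"
  shows
    "(d \<in> {0<..<p} \<longrightarrow>
        (achievable_rates P U d \<noteq> {} \<longleftrightarrow> U 0 1 + U 1 0 < 0) \<and>
        (U 0 1 + U 1 0 < 0 \<longrightarrow>
           rate_inf P U d = ereal (rate_distortion P d) \<and>
           (p + d < 1 / 2 \<longrightarrow> rate_sup P U d \<in> {ereal (binary_entropy (p + d))..1}) \<and>
           (\<not> p + d < 1 / 2 \<longrightarrow> rate_sup P U d = 1)) \<and>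
        (U 0 1 < 0 \<and> U 1 0 < 0 \<longrightarrow> achievable_rates P U d = {rate_distortion P d..1})) \<and>
     (d \<in> {0<..1} \<and> p \<le> d \<longrightarrow> rate_inf P U d = 0)"
proof (intro conjI impI)
  note P = assms(1,2) and U = assms(4,5)
  {
    assume d: "d \<in> {0<..<p}"
    then have pd: "0 < d" "d < p" "0 < p" "d \<le> 1 / 2" "p \<le> 1 / 2"
      using assms(3) by auto
    note RD = rate_distortion_bit[OF P pd(1,2,5)]
    have ge: "rate_distortion P d \<le> R" if "R \<in> achievable_rates P U d" for R
      using achievable_rate_ge[OF P pd(3,5,1,4)] that by (simp add: achievable_rates_def RD)
    have le: "R \<le> 1" if "R \<in> achievable_rates P U d" for R
      using achievable_rate_bounds(2) that by (auto simp: achievable_rates_def)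
    have RD_in: "rate_distortion P d \<in> achievable_rates P U d" if "U 0 1 + U 1 0 < 0"
      using achievable_entropy_diff[of P p d d U] P U pd that by (simp add: achievable_rates_def RD)
    show "achievable_rates P U d \<noteq> {} \<longleftrightarrow> U 0 1 + U 1 0 < 0"
      using RD_in not_achievable[of P p d U, OF P assms(3) pd(2) U] by (force simp: achievable_rates_def not_less)
    have layer: "binary_entropy t \<in> achievable_rates P U d"
      if "U 0 1 + U 1 0 < 0" "0 < t" "t < 1" "\<bar>p - t\<bar> \<le> d" for t
      using achievable_layer_entropy[of P p d t U] P U pd that by (simp add: achievable_rates_def)
    have sup_le: "rate_sup P U d \<le> 1"
      unfolding rate_sup_def using le by (auto intro!: Sup_least simp: one_ereal_def)
    {
      assume neg: "U 0 1 + U 1 0 < 0"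
      show "rate_inf P U d = ereal (rate_distortion P d)"
        unfolding rate_inf_def using RD_in[OF neg] ge
        by (intro antisym Inf_lower Inf_greatest) auto
      show "rate_sup P U d \<in> {ereal (binary_entropy (p + d))..1}" if "p + d < 1 / 2"
      proof -
        have "binary_entropy (p + d) \<in> achievable_rates P U d"
          using pd that by (intro layer[OF neg]) auto
        then have "ereal (binary_entropy (p + d)) \<le> rate_sup P U d"
          unfolding rate_sup_def by (intro Sup_upper) auto
        then show ?thesis
          using sup_le by simp
      qed
      show "rate_sup P U d = 1" if "\<not> p + d < 1 / 2"
      proof -
        \<comment> \<open>The negated inequality puts 1/2 within \<open>d\<close> of
          \<open>p\<close>, so the layer of balanced sequences is admissible.\<close>
        have "binary_entropy (1 / 2) \<in> achievable_rates P U d"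
          using pd that by (intro layer[OF neg]) auto
        moreover have "binary_entropy (1 / 2) = 1"
          by (simp add: binary_entropy_def log_divide)
        ultimately have "ereal 1 \<le> rate_sup P U d"
          unfolding rate_sup_def by (intro Sup_upper) auto
        then show ?thesis
          using sup_le by (simp add: one_ereal_def)
      qed
    }
    assume neg: "U 0 1 < 0 \<and> U 1 0 < 0"
    show "achievable_rates P U d = {rate_distortion P d..1}"
    proof
      show "achievable_rates P U d \<subseteq> {rate_distortion P d..1}"
        using ge le by auto
      show "{rate_distortion P d..1} \<subseteq> achievable_rates P U d"
      proof
        fix R
        assume R: "R \<in> {rate_distortion P d..1}"
        have "0 \<le> rate_distortion P d"
          using achievable_rate_bounds(1)[of P U d] RD_in neg by (simp add: achievable_rates_def)
        show "R \<in> achievable_rates P U d"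
        \<comment> \<open>From the entropy upwards the image is enlarged beyond the typical set.
          Below it, the difference \<open>binary_entropy p - R\<close> is positive and at most
          \<open>binary_entropy d\<close>, hence the entropy of some \<theta> \<le>
          \<open>d\<close>, and a covering code applies.\<close>
        proof (cases "binary_entropy p \<le> R")
          case True
          then show ?thesis
            using achievable_above_entropy[of P p d U R, OF P pd(3,5) _ U] neg R \<open>0 \<le> rate_distortion P d\<close> pd
            by (simp add: achievable_rates_def)
        next
          case False
          obtain \<theta> where "0 < \<theta>" "\<theta> \<le> d" "binary_entropy \<theta> = binary_entropy p - R"
            using binary_entropy_interpolate[of d "binary_entropy p - R"] False R pd by (auto simp: RD)
          then show ?thesis
            using achievable_entropy_diff[of P p \<theta> d U] P U pd neg by (simp add: achievable_rates_def)
        qed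
      qed
    qed
  }
  assume "d \<in> {0<..1} \<and> p \<le> d"
  then have "0 \<in> achievable_rates P U d"
    using achievable_0[of P p d U] P by (simp add: achievable_rates_def)
  moreover have "0 \<le> R" if "R \<in> achievable_rates P U d" for R
    using achievable_rate_bounds(1) that by (auto simp: achievable_rates_def)
  ultimately show "rate_inf P U d = 0"
    unfolding rate_inf_def zero_ereal_def by (intro antisym Inf_lower Inf_greatest) auto
qed

end
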